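(* The following two identities hold in the ring $\mathbb{Q}[[q]][[X]]$ of formal power series in $X$ with coefficients in $\mathbb{Q}[[q]]$: \begin{align*} 1+ \sum_{r\geq 1} A_r(q)\, X^{2r} &= \frac{2}{X} \arcsin\left( \frac{X}{2} \right) \exp\left( \sum_{j \geq 1} \frac{(-1)^{j-1}}{j}\, G_{2j}(q) \left( 2 \arcsin\left( \frac{X}{2} \right)\right)^{2j} \right),\\ 1+\sum_{r\geq 1} C_r(q)\, X^{2r} &= \exp\left( \sum_{j \geq 1} \frac{(-1)^{j-1}}{j}\, G^{\mathbf{o}}_{2j}(q) \left( 2 \arcsin\left( \frac{X}{2} \right)\right)^{2j} \right). \end{align*}
   Context: For $r\geq 1$, MacMahon's $q$-series are $$A_r(q) = \sum_{m_1>\dots>m_r>0} \frac{q^{m_1+\dots+m_r}}{(1-q^{m_1})^2\cdots (1-q^{m_r})^2}, \qquad C_r(q) = \sum_{\substack{m_1>\dots>m_r>0\\ m_1,\dots,m_r \text{ odd}}}\frac{q^{m_1+\dots+m_r}}{(1-q^{m_1})^2\cdots (1-q^{m_r})^2},$$ where the $m_i$ are integers; both are viewed as elements of $\mathbb{Q}[[q]]$. For $k\geq 2$, the Eisenstein series of weight $k$ and its odd variant are $$G_k(q) = -\frac{B_k}{2\,k!} + \frac{1}{(k-1)!}\sum_{m,n \geq 1} n^{k-1} q^{mn}, \qquad G^{\mathbf{o}}_k(q) = G_k(q) - G_k(q^2) = \frac{1}{(k-1)!}\sum_{\substack{m,n \geq 1\\ m \text{ odd}}} n^{k-1} q^{mn},$$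 where $B_k$ is the $k$-th Bernoulli number (so $B_2=\tfrac16$). Here $\arcsin(X/2)$ denotes its Taylor series at $X=0$, so that $2\arcsin(X/2) = X + \dots\in X\,\mathbb{Q}[[X]]$ and $\frac{2}{X}\arcsin(X/2)\in 1+X^2\mathbb{Q}[[X]]$; $\exp$ is the formal exponential series. *)

theory Defs
  imports "HOL-Analysis.Analysis"
begin

text \<open>
  The ring of formal power series in \<open>q\<close> over the rationals is the type \<^typ>\<open>rat fps\<close> (there
  \<^const>\<open>fps_X\<close> is \<open>q\<close>), and the ring of formal power series in \<open>X\<close> over it is \<^typ>\<open>rat fps fps\<close>
  (there \<^const>\<open>fps_X\<close> is \<open>X\<close>). Infinite sums are \<^const>\<open>infsum\<close> for the library's topology on
  formal power series, in which a net converges iff each coefficient is eventually constant.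
  \<^const>\<open>infsum\<close> is 0 on families that are not summable; the lemmas below show that every family
  used here is summable.
\<close>

lemma has_sum_fps:
  fixes f :: "'a \<Rightarrow> 'b::ab_group_add fps"
  assumes fin: "\<And>N. finite {x \<in> A. fps_nth (f x) N \<noteq> 0}"
  shows "(f has_sum Abs_fps (\<lambda>N. \<Sum>x | x \<in> A \<and> fps_nth (f x) N \<noteq> 0. fps_nth (f x) N)) A"
  unfolding has_sum_def
proof (rule tendsto_fpsI)
  fix N
  let ?B = "{x \<in> A. fps_nth (f x) N \<noteq> 0}"
  have "fps_nth (sum f Y) N = (\<Sum>x\<in>?B. fps_nth (f x) N)"
    if "finite Y" "?B \<subseteq> Y" "Y \<subseteq> A" for Y
    unfolding fps_sum_nth by (rule sum.mono_neutral_right) (use that in auto)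
  then show "\<forall>\<^sub>F Y in finite_subsets_at_top A. fps_nth (sum f Y) N =
      fps_nth (Abs_fps (\<lambda>N. \<Sum>x | x \<in> A \<and> fps_nth (f x) N \<noteq> 0. fps_nth (f x) N)) N"
    unfolding eventually_finite_subsets_at_top
    by (intro exI[of _ ?B]) (use fin[of N] in auto)
qed

lemma fps_nth_infsum:
  fixes f :: "'a \<Rightarrow> 'b::ab_group_add fps"
  assumes "\<And>N. finite {x \<in> A. fps_nth (f x) N \<noteq> 0}"
  shows "fps_nth (\<Sum>\<^sub>\<infinity>x\<in>A. f x) N = (\<Sum>x | x \<in> A \<and> fps_nth (f x) N \<noteq> 0. fps_nth (f x) N)"
  by (simp add: infsumI[OF has_sum_fps[OF assms]])

lemma summable_on_fps:
  fixes f :: "'a \<Rightarrow> 'b::ab_group_add fps"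
  assumes "\<And>N. finite {x \<in> A. fps_nth (f x) N \<noteq> 0}"
  shows "f summable_on A"
  using has_sum_fps[OF assms] by (auto simp: summable_on_def)


section \<open>MacMahon's series\<close>

text \<open>The tuples \<open>m\<^sub>1 > \<dots> > m\<^sub>r > 0\<close>.\<close>

definition decreasing_tuples :: "nat \<Rightarrow> nat list set" where
  "decreasing_tuples r = {ms. length ms = r \<and> sorted_wrt (>) ms \<and> (\<forall>m\<in>set ms. m > 0)}"

definition macmahon_term :: "nat list \<Rightarrow> rat fps" where
  "macmahon_term ms = fps_X ^ sum_list ms / (\<Prod>m\<leftarrow>ms. (1 - fps_X ^ m)\<^sup>2)"

definition macmahon_A :: "nat \<Rightarrow> rat fps" where
  "macmahon_A r = (\<Sum>\<^sub>\<infinity>ms\<in>decreasing_tuples r. macmahon_term ms)"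

definition macmahon_C :: "nat \<Rightarrow> rat fps" where
  "macmahon_C r = (\<Sum>\<^sub>\<infinity>ms\<in>{ms \<in> decreasing_tuples r. \<forall>m\<in>set ms. odd m}. macmahon_term ms)"

lemma macmahon_finite:
  "finite {ms \<in> decreasing_tuples r. fps_nth (macmahon_term ms) N \<noteq> 0}"
proof (rule finite_subset)
  show "{ms \<in> decreasing_tuples r. fps_nth (macmahon_term ms) N \<noteq> 0} \<subseteq>
      {ms. set ms \<subseteq> {..N} \<and> length ms = r}"
  proof safe
    fix ms m assume ms: "ms \<in> decreasing_tuples r" "fps_nth (macmahon_term ms) N \<noteq> 0"
      and m: "m \<in> set ms"
    let ?D = "\<lambda>ms. \<Prod>m\<leftarrow>ms. (1 - fps_X ^ m)\<^sup>2 :: rat fps"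
    have "fps_nth (?D ms) 0 \<noteq> 0" if "\<forall>m\<in>set ms. m > 0" for ms :: "nat list"
      using that by (induction ms) (auto simp: fps_mult_nth_0 fps_power_zeroth power_0_left)
    then have "macmahon_term ms = fps_X ^ sum_list ms * inverse (?D ms)"
      using ms(1) by (simp add: macmahon_term_def decreasing_tuples_def fps_divide_unit)
    then have "sum_list ms \<le> N"
      using ms(2) by (auto simp: fps_X_power_mult_nth split: if_splits)
    then show "m \<le> N"
      using member_le_sum_list[OF m] by linarith
  qed (auto simp: decreasing_tuples_def)
qed (simp add: finite_lists_length_eq)

lemma macmahon_A_summable: "macmahon_term summable_on decreasing_tuples r"
  by (rule summable_on_fps[OF macmahon_finite])

lemma macmahon_C_summable:
  "macmahon_term summable_on {ms \<in> decreasing_tuples r. \<forall>m\<in>set ms. odd m}"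
proof (rule summable_on_fps)
  show "finite {ms \<in> {ms \<in> decreasing_tuples r. \<forall>m\<in>set ms. odd m}.
      fps_nth (macmahon_term ms) N \<noteq> 0}" for N
    by (rule finite_subset[OF _ macmahon_finite[of r N]]) auto
qed


section \<open>Eisenstein series\<close>

text \<open>Bernoulli numbers, from \<open>t / (e\<^sup>t - 1) = (\<Sum>n. B\<^sub>n t\<^sup>n / n!)\<close>.\<close>

definition bernoulli_number :: "nat \<Rightarrow> rat" where
  "bernoulli_number n = fact n * fps_nth (fps_X / (fps_exp 1 - 1)) n"

definition eisenstein :: "nat \<Rightarrow> rat fps" where
  "eisenstein k = fps_const (- bernoulli_number k / (2 * fact k)) +
     fps_const (1 / fact (k - 1)) *
       (\<Sum>\<^sub>\<infinity>(m, n)\<in>{1..} \<times> {1..}. of_nat (n ^ (k - 1)) * fps_X ^ (m * n))"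

definition eisenstein_odd :: "nat \<Rightarrow> rat fps" where
  "eisenstein_odd k = eisenstein k - (eisenstein k oo fps_X\<^sup>2)"

lemma bernoulli_number_2: "bernoulli_number 2 = 1/6"
proof -
  define E :: "rat fps" where "E = fps_exp 1 - 1"
  have nz: "E \<noteq> 0"
  proof
    assume "E = 0"
    then have "fps_nth E 1 = 0" by simp
    then show False by (simp add: E_def)
  qed
  have sd: "subdegree E = 1"
    by (rule subdegreeI) (auto simp: E_def)
  define Q where "Q = fps_X / E"
  have "Q * E = fps_X"
    unfolding Q_def by (rule fps_times_divide_eq) (use nz sd in auto)
  then have eq: "fps_nth (Q * E) n = fps_nth fps_X n" for n
    by simp
  have "fps_nth Q 0 = 1"
    using eq[of 1] by (simp add: fps_mult_nth E_def)
  moreover have "fps_nth Q 0 / 2 + fps_nth Q 1 = 0"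
    using eq[of 2] by (simp add: fps_mult_nth E_def numeral_2_eq_2 fact_numeral)
  moreover have "fps_nth Q 0 / 6 + fps_nth Q 1 / 2 + fps_nth Q 2 = 0"
    using eq[of 3] by (simp add: fps_mult_nth E_def numeral_3_eq_3 numeral_2_eq_2 fact_numeral)
  ultimately have "fps_nth Q 2 = 1 / 12" by simp
  then show ?thesis
    by (simp add: bernoulli_number_def Q_def E_def fact_numeral)
qed

lemma eisenstein_term_nth:
  "fps_nth (of_nat (n ^ e) * fps_X ^ s :: rat fps) N = (if N = s then of_nat (n ^ e) else 0)"
  by (simp add: fps_of_nat[symmetric] del: of_nat_power)

lemma eisenstein_finite:
  "finite {(m, n) \<in> {1..} \<times> {1..}. m * n = (N::nat)}"
proof (rule finite_subset)
  show "{(m, n) \<in> {1..} \<times> {1..}. m * n = N} \<subseteq> {..N} \<times> {..N}"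
    by auto
qed simp

lemma eisenstein_support:
  "{x \<in> B. fps_nth ((\<lambda>(m, n). of_nat (n ^ e) * fps_X ^ (m * n) :: rat fps) x) N \<noteq> 0} =
   {(m, n) \<in> B. m * n = N}" if "B \<subseteq> {1..} \<times> {1..}"
  using that by (auto simp: eisenstein_term_nth split: if_splits simp del: of_nat_power)

lemma eisenstein_support_finite:
  assumes "B \<subseteq> {1..} \<times> {1..}"
  shows "finite {x \<in> B. fps_nth ((\<lambda>(m, n). of_nat (n ^ e) * fps_X ^ (m * n) :: rat fps) x) N \<noteq> 0}"
  unfolding eisenstein_support[OF assms]
  by (rule finite_subset[OF _ eisenstein_finite[of N]]) (use assms in auto)

lemma eisenstein_summable:
  assumes "B \<subseteq> {1..} \<times> {1..}"
  shows "(\<lambda>(m, n). of_nat (n ^ e) * fps_X ^ (m * n) :: rat fps) summable_on B"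
  by (rule summable_on_fps[OF eisenstein_support_finite[OF assms]])

lemma eisenstein_sum_nth:
  assumes "B \<subseteq> {1..} \<times> {1..}"
  shows "fps_nth (\<Sum>\<^sub>\<infinity>(m, n)\<in>B. of_nat (n ^ e) * fps_X ^ (m * n) :: rat fps) N =
    (\<Sum>(m, n) | (m, n) \<in> B \<and> m * n = N. of_nat (n ^ e))"
  unfolding fps_nth_infsum[OF eisenstein_support_finite[OF assms]]
    eisenstein_support[OF assms]
  by (rule sum.cong) (auto simp: eisenstein_term_nth simp del: of_nat_power)

lemma eisenstein_odd_altdef:
  "eisenstein_odd k = fps_const (1 / fact (k - 1)) *
     (\<Sum>\<^sub>\<infinity>(m, n)\<in>{m. odd m} \<times> {1..}. of_nat (n ^ (k - 1)) * fps_X ^ (m * n))"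
proof (rule fps_ext)
  fix N
  let ?P = "\<lambda>B N. {(m, n). (m, n) \<in> B \<and> m * n = (N::nat)}"
  define s where "s B N = (\<Sum>(m, n)\<in>?P B N. of_nat (n ^ (k - 1)) :: rat)" for B N
  define U where "U = {1::nat..} \<times> {1::nat..}"
  define O' where "O' = {m::nat. odd m} \<times> {1::nat..}"
  define E where "E = {m::nat. even m \<and> m > 0} \<times> {1::nat..}"
  have sub: "O' \<subseteq> U" "E \<subseteq> U" by (auto simp: O'_def E_def U_def Suc_le_eq odd_pos)
  have fin: "finite (?P B N)" if "B \<subseteq> U" for B N
    by (rule finite_subset[OF _ eisenstein_finite[of N]]) (use that in \<open>auto simp: U_def\<close>)
  have split: "s U N = s O' N + s E N"
  proof -
    have "?P U N = ?P O' N \<union> ?P E N"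
      by (auto simp: O'_def E_def U_def Suc_le_eq odd_pos)
    moreover have "?P O' N \<inter> ?P E N = {}"
      by (auto simp: O'_def E_def)
    ultimately show ?thesis
      unfolding s_def by (metis (no_types, lifting) sum.union_disjoint fin sub)
  qed
  have dbl: "s E N = (if even N then s U (N div 2) else 0)"
  proof (cases "even N")
    case True
    then obtain M where M: "N = 2 * M" by blast
    have "s E N = s U M"
      unfolding s_def
      by (rule sum.reindex_bij_witness[of _ "\<lambda>(m, n). (2 * m, n)" "\<lambda>(m, n). (m div 2, n)"])
        (auto simp: M E_def U_def)
    then show ?thesis using M by simp
  next
    case False
    then have P: "?P E N = {}" by (auto simp: E_def)
    show ?thesis using False unfolding s_def P by simp
  qed
  have comp: "fps_nth (f oo fps_X\<^sup>2) N = (if even N then fps_nth f (N div 2) else 0)"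
    for f :: "rat fps"
  proof -
    have "fps_nth (f oo fps_X\<^sup>2) N = (\<Sum>i\<in>{0..N}. if N = 2 * i then fps_nth f i else 0)"
      unfolding fps_compose_nth power_mult[symmetric]
      by (intro sum.cong refl) simp
    also have "\<dots> = (\<Sum>i\<in>(if even N then {N div 2} else {}). fps_nth f i)"
      by (intro sum.mono_neutral_cong_right) (auto split: if_splits)
    finally show ?thesis by simp
  qed
  have nth: "fps_nth (eisenstein k) N = (if N = 0 then - bernoulli_number k / (2 * fact k) else 0) +
      1 / fact (k - 1) * s U N" for N
    unfolding eisenstein_def s_def U_def by (simp add: eisenstein_sum_nth del: of_nat_power)
  have "fps_nth (eisenstein_odd k) N = 1 / fact (k - 1) * s O' N"
  proof (cases "even N")
    case True
    then have "N div 2 = 0 \<longleftrightarrow> N = 0" by auto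
    then show ?thesis
      unfolding eisenstein_odd_def fps_sub_nth comp nth split dbl
      using True by (simp add: distrib_left)
  next
    case False
    then have "N \<noteq> 0" by (intro notI) simp
    then show ?thesis
      unfolding eisenstein_odd_def fps_sub_nth comp nth split dbl
      using False by simp
  qed
  also have "\<dots> = fps_nth (fps_const (1 / fact (k - 1)) *
     (\<Sum>\<^sub>\<infinity>(m, n)\<in>O'. of_nat (n ^ (k - 1)) * fps_X ^ (m * n))) N"
    using eisenstein_sum_nth[of O' "k - 1" N] sub(1)
    unfolding fps_mult_left_const_nth s_def U_def by simp
  finally show "fps_nth (eisenstein_odd k) N = fps_nth (fps_const (1 / fact (k - 1)) *
     (\<Sum>\<^sub>\<infinity>(m, n)\<in>{m. odd m} \<times> {1..}. of_nat (n ^ (k - 1)) * fps_X ^ (m * n))) N"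
    unfolding O'_def .
qed


section \<open>Power series in \<open>X\<close>\<close>

text \<open>The inclusion of the power series with rational coefficients into those with coefficients
  that are themselves power series in \<open>q\<close>.\<close>

definition lift_coeffs :: "rat fps \<Rightarrow> rat fps fps" where
  "lift_coeffs f = Abs_fps (\<lambda>n. fps_const (fps_nth f n))"

text \<open>\<open>exp F\<close>, for \<open>F\<close> with constant term 0 (in \<open>X\<close>). The library's \<^const>\<open>fps_exp\<close> needs a field
  of coefficients, hence the detour through \<^const>\<open>lift_coeffs\<close>.\<close>

definition exp_series :: "rat fps fps \<Rightarrow> rat fps fps" where
  "exp_series F = lift_coeffs (fps_exp 1) oo F"

text \<open>The Taylor series at 0 of the real function \<open>x \<mapsto> arcsin (x / 2)\<close>; its coefficients are
  rational, see \<open>arcsin_half_expansion\<close>.\<close>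

definition arcsin_half :: "rat fps" where
  "arcsin_half = (THE f. (\<lambda>x::real. arcsin (x / 2)) has_fps_expansion
     Abs_fps (\<lambda>n. of_rat (fps_nth f n)))"

lemma has_fps_expansion_unique_real:
  fixes f :: "real \<Rightarrow> real"
  assumes "f has_fps_expansion F" "f has_fps_expansion G"
  shows "F = G"
proof (rule fps_ext)
  show "fps_nth F n = fps_nth G n" for n
    using assms
  proof (induction n arbitrary: f F G)
    case 0
    then have "eval_fps F 0 = f 0" "eval_fps G 0 = f 0"
      by (auto simp: has_fps_expansion_def dest: eventually_nhds_x_imp_x)
    then show ?case by (simp add: eval_fps_at_0)
  next
    case (Suc n)
    have "fps_nth (fps_deriv F) n = fps_nth (fps_deriv G) n"
      by (rule Suc.IH) (use Suc.prems in \<open>auto intro: has_fps_expansion_deriv\<close>)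
    then show ?case by (simp del: of_nat_Suc)
  qed
qed

lemma of_rat_gbinomial: "of_rat (a gchoose k) = (of_rat a :: real) gchoose k"
proof -
  have "of_rat (fact k) = (fact k :: real)"
    by (metis of_nat_fact of_rat_of_nat_eq)
  then show ?thesis
    by (simp add: gbinomial_prod_rev of_rat_divide of_rat_prod of_rat_diff)
qed

lemma arcsin_half_exists:
  "\<exists>f :: rat fps. (\<lambda>x::real. arcsin (x / 2)) has_fps_expansion Abs_fps (\<lambda>n. of_rat (fps_nth f n))"
proof -
  define d :: "nat \<Rightarrow> rat" where
    "d n = (if even n then 1/2 * (((-1/2) gchoose (n div 2)) * (-1/4) ^ (n div 2)) else 0)" for n
  define f :: "rat fps" where "f = Abs_fps (\<lambda>n. case n of 0 \<Rightarrow> 0 | Suc m \<Rightarrow> d m / of_nat n)"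
  define F :: "real fps" where "F = Abs_fps (\<lambda>n. of_rat (fps_nth f n))"
  have d_eq: "of_rat (d n) = (if even n then 1/2 * (((-1/2) gchoose (n div 2)) * (-1/4) ^ (n div 2)) else (0::real))" for n
    by (simp add: d_def of_rat_mult of_rat_divide of_rat_minus of_rat_power of_rat_gbinomial)
  have F_deriv: "fps_nth (fps_deriv F) n = of_rat (d n)" for n
  proof -
    have "fps_nth (fps_deriv F) n = of_nat (Suc n) * of_rat (d n / of_nat (Suc n))"
      by (simp add: F_def f_def del: of_nat_Suc)
    also have "\<dots> = of_rat (d n)"
      by (simp add: of_rat_divide del: of_nat_Suc)
    finally show ?thesis .
  qed
  have sums: "(\<lambda>n. fps_nth (fps_deriv F) n * x ^ n) sums (1/2 * (1 - x\<^sup>2 / 4) powr (-1/2))"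
    if "\<bar>x\<bar> < 1" for x :: real
  proof -
    have "x\<^sup>2 < 1" using that by (simp add: abs_square_less_1)
    then have "(\<lambda>n. ((-1/2) gchoose n) * (- (x\<^sup>2 / 4)) ^ n) sums (1 + - (x\<^sup>2 / 4)) powr (-1/2)"
      by (intro gen_binomial_real) simp
    then have "(\<lambda>n. 1/2 * (((-1/2) gchoose n) * (- (x\<^sup>2 / 4)) ^ n)) sums
        (1/2 * (1 - x\<^sup>2 / 4) powr (-1/2))"
      by (intro sums_mult) simp
    also have "(\<lambda>n. 1/2 * (((-1/2) gchoose n) * (- (x\<^sup>2 / 4)) ^ n)) =
        (\<lambda>n. of_rat (d (2 * n)) * x ^ (2 * n))"
    proof
      fix n
      have "(- (x\<^sup>2 / 4)) ^ n = ((-1/4) * x\<^sup>2) ^ n" by simp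
      also have "\<dots> = (-1/4) ^ n * x ^ (2 * n)" by (simp only: power_mult_distrib power_mult)
      finally show "1/2 * (((-1/2) gchoose n) * (- (x\<^sup>2 / 4)) ^ n) = of_rat (d (2 * n)) * x ^ (2 * n)"
        by (simp add: d_eq)
    qed
    finally show ?thesis
      unfolding F_deriv
      by (subst (asm) sums_mono_reindex[of "\<lambda>n. 2 * n" "\<lambda>n. of_rat (d n) * x ^ n"])
        (auto simp: strict_mono_def d_eq elim!: evenE)
  qed
  have summ_F: "summable (\<lambda>n. fps_nth F n * (1/2) ^ n)"
  proof (rule summable_comparison_test')
    have "summable (\<lambda>n. norm (fps_nth (fps_deriv F) n * (1/2) ^ n))"
      by (rule powser_insidea[of _ "3/4"]) (use sums[of "3/4"] in \<open>auto simp: sums_iff\<close>)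
    then have "summable (\<lambda>n. norm (fps_nth (fps_deriv F) (n - 1) * (1/2) ^ (n - 1)))"
      by (subst summable_Suc_iff[symmetric]) simp
    then show "summable (\<lambda>n. norm (fps_nth (fps_deriv F) (n - 1) * (1/2) ^ (n - 1)))" .
    show "norm (fps_nth F n * (1/2) ^ n) \<le> norm (fps_nth (fps_deriv F) (n - 1) * (1/2) ^ (n - 1))" for n
    proof (cases n)
      case 0
      then show ?thesis by (simp add: F_def f_def)
    next
      case (Suc m)
      have "\<bar>fps_nth F n\<bar> \<le> \<bar>fps_nth (fps_deriv F) m\<bar>"
        using Suc by (simp add: fps_deriv_nth abs_mult mult_le_cancel_right1)
      moreover have "(1/2::real) ^ n \<le> (1/2) ^ m" using Suc by simp
      ultimately show ?thesis
        using Suc by (simp add: abs_mult mult_mono del: power_Suc fps_deriv_nth)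
    qed
  qed
  have rad: "fps_conv_radius F \<ge> ereal (1/2)"
    unfolding fps_conv_radius_def
    using conv_radius_geI[OF summ_F] by simp
  have eq: "eval_fps F x = arcsin (x / 2)" if x: "\<bar>x\<bar> < 1/2" for x :: real
  proof -
    have "((\<lambda>x. eval_fps F x - arcsin (x / 2)) has_field_derivative 0) (at y within ball 0 (1/2))"
      if y: "y \<in> ball 0 (1/2)" for y :: real
    proof -
      have y': "\<bar>y\<bar> < 1/2" using y by (simp add: dist_norm)
      then have "ereal (norm y) < ereal (1/2)" by simp
      then have "ereal (norm y) < fps_conv_radius F" using rad by (rule less_le_trans)
      then have 1: "(eval_fps F has_field_derivative eval_fps (fps_deriv F) y) (at y within ball 0 (1/2))"
        by (rule has_field_derivative_eval_fps)
      have 2: "eval_fps (fps_deriv F) y = 1/2 * (1 - y\<^sup>2 / 4) powr (-1/2)"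
        using sums[of y] y' by (simp add: eval_fps_def sums_iff)
      have pos: "1 - y\<^sup>2 / 4 > 0"
      proof -
        have "y\<^sup>2 < 1" using y' by (simp add: abs_square_less_1)
        then show ?thesis by simp
      qed
      have pow: "(1 - y\<^sup>2 / 4) powr (-1/2) = inverse (sqrt (1 - (y / 2)\<^sup>2))"
      proof -
        have "(1 - y\<^sup>2 / 4) powr (-1/2) = inverse ((1 - y\<^sup>2 / 4) powr (1/2))"
          by (metis powr_minus minus_divide_left)
        also have "(1 - y\<^sup>2 / 4) powr (1/2) = sqrt (1 - y\<^sup>2 / 4)"
          using pos by (intro powr_half_sqrt) simp
        finally show ?thesis by (simp add: power_divide)
      qed
      have "(arcsin has_field_derivative inverse (sqrt (1 - (y / 2)\<^sup>2))) (at (y / 2))"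
        by (rule DERIV_arcsin) (use y' in simp_all)
      moreover have "((\<lambda>x. x / 2) has_field_derivative 1 / 2) (at y)"
        by (rule DERIV_cdivide) (rule DERIV_ident)
      ultimately have "((\<lambda>x. arcsin (x / 2)) has_field_derivative 1/2 * (1 - y\<^sup>2 / 4) powr (-1/2)) (at y)"
        unfolding pow by (metis DERIV_chain2 mult.commute)
      then have 3: "((\<lambda>x. arcsin (x / 2)) has_field_derivative 1/2 * (1 - y\<^sup>2 / 4) powr (-1/2))
          (at y within ball 0 (1/2))"
        by (rule has_field_derivative_at_within)
      show ?thesis
        using DERIV_diff[OF 1[unfolded 2] 3] by simp
    qed
    then have "\<exists>c. \<forall>y\<in>ball 0 (1/2). eval_fps F y - arcsin (y / 2) = c"
      by (intro has_field_derivative_zero_constant) auto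
    then obtain c where c: "\<And>y. \<bar>y\<bar> < 1/2 \<Longrightarrow> eval_fps F y - arcsin (y / 2) = c"
      by (auto simp: dist_norm)
    have "c = 0"
      using c[of 0] by (simp add: eval_fps_at_0 F_def f_def)
    then show ?thesis using c[OF x] by simp
  qed
  have "0 < ereal (1/2)" by simp
  then have "0 < fps_conv_radius F" using rad by (rule less_le_trans)
  moreover have "\<forall>\<^sub>F x in nhds 0. eval_fps F x = arcsin (x / 2)"
    unfolding eventually_nhds_metric
    by (rule exI[of _ "1/2"]) (simp add: eq dist_norm)
  ultimately have "(\<lambda>x. arcsin (x / 2)) has_fps_expansion F"
    by (simp add: has_fps_expansion_def)
  then show ?thesis unfolding F_def by blast
qed

lemma arcsin_half_expansion:
  "(\<lambda>x::real. arcsin (x / 2)) has_fps_expansion Abs_fps (\<lambda>n. of_rat (fps_nth arcsin_half n))"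
proof -
  obtain f :: "rat fps" where
    f: "(\<lambda>x::real. arcsin (x / 2)) has_fps_expansion Abs_fps (\<lambda>n. of_rat (fps_nth f n))"
    using arcsin_half_exists by blast
  show ?thesis
    unfolding arcsin_half_def
  proof (rule theI[of _ f])
    fix g :: "rat fps"
    assume "(\<lambda>x::real. arcsin (x / 2)) has_fps_expansion Abs_fps (\<lambda>n. of_rat (fps_nth g n))"
    from has_fps_expansion_unique_real[OF this f] show "g = f"
      by (auto simp: fps_eq_iff)
  qed (rule f)
qed

lemma arcsin_half_nth_0: "fps_nth arcsin_half 0 = 0"
proof -
  have "\<forall>\<^sub>F x in nhds 0. eval_fps (Abs_fps (\<lambda>n. real_of_rat (fps_nth arcsin_half n))) x = arcsin (x / 2)"
    using arcsin_half_expansion unfolding has_fps_expansion_def by (rule conjunct2)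
  then have "eval_fps (Abs_fps (\<lambda>n. real_of_rat (fps_nth arcsin_half n))) 0 = arcsin (0 / 2)"
    by (rule eventually_nhds_x_imp_x)
  then show ?thesis by (simp add: eval_fps_at_0)
qed


section \<open>Summability of the sums over powers of \<open>X\<close>\<close>

lemma summable_on_fps_powers:
  fixes F :: "'b::comm_ring_1 fps"
  assumes "fps_nth F 0 = 0"
  shows "(\<lambda>j. fps_const (c j) * F ^ (2 * j)) summable_on {1..}"
proof (rule summable_on_fps)
  fix N
  show "finite {j \<in> {1..}. fps_nth (fps_const (c j) * F ^ (2 * j)) N \<noteq> 0}"
  proof (rule finite_subset)
    show "{j \<in> {1..}. fps_nth (fps_const (c j) * F ^ (2 * j)) N \<noteq> 0} \<subseteq> {..N}"
    proof
      fix j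
      assume "j \<in> {j \<in> {1..}. fps_nth (fps_const (c j) * F ^ (2 * j)) N \<noteq> 0}"
      then have "c j * fps_nth (F ^ (2 * j)) N \<noteq> 0"
        by (simp only: mem_Collect_eq fps_mult_left_const_nth not_False_eq_True)
      then have "fps_nth (F ^ (2 * j)) N \<noteq> 0"
        by (metis mult_zero_right)
      with startsby_zero_power_prefix[OF assms, of "2 * j"] have "\<not> N < 2 * j"
        by blast
      then show "j \<in> {..N}"
        by simp
    qed
  qed simp
qed

lemma lift_arcsin_half_nth_0: "fps_nth (lift_coeffs (2 * arcsin_half)) 0 = 0"
  by (simp add: lift_coeffs_def fps_mult_nth arcsin_half_nth_0)

lemmas theorem_sums_summable =
  summable_on_fps_powers[of fps_X macmahon_A, simplified]
  summable_on_fps_powers[of fps_X macmahon_C, simplified]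
  summable_on_fps_powers[OF lift_arcsin_half_nth_0,
    of "\<lambda>j. fps_const ((-1) ^ (j - 1) / of_nat j) * eisenstein (2 * j)"]
  summable_on_fps_powers[OF lift_arcsin_half_nth_0,
    of "\<lambda>j. fps_const ((-1) ^ (j - 1) / of_nat j) * eisenstein_odd (2 * j)"]

end

theory Submission
  imports Defs
begin

text \<open>
  Both left-hand sides are products of factors \<open>1 + X\<^sup>2 q\<^sup>m / (1 - q\<^sup>m)\<^sup>2\<close>. With
  \<open>Y = 2 arcsin (X/2)\<close> one has \<open>X\<^sup>2 = 2 - 2 cos Y\<close>, so a factor equals
  \<open>(1 - 2 cos Y q\<^sup>m + q\<^bsup>2m\<^esup>) / (1 - q\<^sup>m)\<^sup>2\<close>. The \<open>Y\<close>-derivative of its logarithm is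
  \<open>2 (\<Sum>n\<ge>1. sin (n Y) q\<^bsup>mn\<^esup>)\<close>, because \<open>sin ((n + 1) Y) + sin ((n - 1) Y) = 2 cos Y sin (n Y)\<close>;
  expanding the sines and summing over \<open>m\<close> gives the divisor sums of the Eisenstein series. In the
  first identity the constant terms of the Eisenstein series contribute \<open>sin (Y/2) / (Y/2) = X / Y\<close>,
  by the generating function of the Bernoulli numbers, and this cancels the factor in front. Infinite
  products are avoided by working modulo each \<open>q\<^bsup>M+1\<^esup>\<close>, and logarithms by the differential
  equation \<open>P' = F' P\<close> that characterises \<open>P = exp F\<close>.
\<close>


section \<open>Formal exponentials\<close>

text \<open>Coefficient \<open>m\<close> of \<open>H * D\<close> involves only coefficients of
  \<open>D\<close> up to \<open>m\<close>, so it forces coefficient \<open>Suc m\<close> of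
  \<open>D\<close> to vanish once the earlier ones do.\<close>

lemma fps_linear_ode_zero:
  fixes D :: "'a::{idom, semiring_char_0} fps"
  assumes "fps_deriv D = H * D" "fps_nth D 0 = 0"
  shows "D = 0"
proof (rule fps_ext)
  show "fps_nth D n = fps_nth 0 n" for n
  proof (induction n rule: less_induct)
    case (less n)
    show ?case
    proof (cases n)
      case (Suc m)
      have "of_nat (Suc m) * fps_nth D (Suc m) = fps_nth (H * D) m"
        by (simp flip: assms(1))
      also have "\<dots> = 0"
        unfolding fps_mult_nth using less Suc by (intro sum.neutral) auto
      finally show ?thesis
        using Suc by (simp del: of_nat_Suc)
    qed (use assms(2) in simp)
  qed
qed

lemma fps_linear_ode_unique:
  fixes P Q :: "'a::{idom, semiring_char_0} fps"
  assumes "fps_deriv P = H * P" "fps_deriv Q = H * Q" "fps_nth P 0 = fps_nth Q 0"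
  shows "P = Q"
  using fps_linear_ode_zero[of "P - Q" H] assms by (simp add: algebra_simps)

section \<open>Compatibility of the coefficient inclusion with the series operations\<close>

lemma lift_coeffs_nth [simp]: "fps_nth (lift_coeffs f) n = fps_const (fps_nth f n)"
  by (simp add: lift_coeffs_def)

lemma lift_coeffs_diff: "lift_coeffs (f - g) = lift_coeffs f - lift_coeffs g"
  by (simp add: fps_eq_iff)

lemma fps_const_sum: "fps_const (sum f A) = (\<Sum>x\<in>A. fps_const (f x))"
  by (simp add: fps_eq_iff fps_sum_nth)

lemma lift_coeffs_mult: "lift_coeffs (f * g) = lift_coeffs f * lift_coeffs g"
  by (rule fps_ext) (simp add: fps_mult_nth fps_const_sum)

lemma lift_coeffs_const: "lift_coeffs (fps_const c) = fps_const (fps_const c)"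
  by (rule fps_ext) simp

lemma lift_coeffs_1 [simp]: "lift_coeffs 1 = 1"
  using lift_coeffs_const[of 1] by simp

lemma lift_coeffs_X [simp]: "lift_coeffs fps_X = fps_X"
  by (rule fps_ext) simp

lemma lift_coeffs_power: "lift_coeffs (f ^ n) = lift_coeffs f ^ n"
  by (induction n) (simp_all add: lift_coeffs_mult)

lemma lift_coeffs_deriv: "fps_deriv (lift_coeffs f) = lift_coeffs (fps_deriv f)"
  by (rule fps_ext) (simp del: of_nat_Suc flip: fps_of_nat)

lemma lift_coeffs_compose: "lift_coeffs f oo lift_coeffs g = lift_coeffs (f oo g)"
  by (rule fps_ext) (simp add: fps_compose_nth fps_const_sum flip: lift_coeffs_power)

lemma exp_series_nth_0: "fps_nth (exp_series F) 0 = 1"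
  by (simp add: exp_series_def)

lemma exp_series_deriv:
  assumes "fps_nth F 0 = 0"
  shows "fps_deriv (exp_series F) = fps_deriv F * exp_series F"
  using assms by (simp add: exp_series_def fps_compose_deriv lift_coeffs_deriv mult.commute)

text \<open>Uniqueness for the linear equation with initial value 1; it replaces taking
  logarithms.\<close>

lemma exp_series_eqI:
  assumes "fps_nth F 0 = 0" "fps_nth P 0 = 1" "fps_deriv P = fps_deriv F * P"
  shows "exp_series F = P"
  using assms
  by (intro fps_linear_ode_unique[OF exp_series_deriv]) (simp_all add: exp_series_nth_0)

lemma exp_series_add:
  assumes "fps_nth F 0 = 0" "fps_nth G 0 = 0"
  shows "exp_series (F + G) = exp_series F * exp_series G"
  using assms
  by (intro exp_series_eqI) (simp_all add: exp_series_nth_0 exp_series_deriv algebra_simps)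

lemma exp_series_sum:
  assumes "finite A" "\<And>x. x \<in> A \<Longrightarrow> fps_nth (F x) 0 = 0"
  shows "exp_series (sum F A) = (\<Prod>x\<in>A. exp_series (F x))"
  using assms
proof (induction A rule: finite_induct)
  case empty
  show ?case by (auto intro!: exp_series_eqI)
next
  case (insert x A)
  then show ?case by (simp add: exp_series_add fps_sum_nth)
qed

lemma exp_series_lift: "exp_series (lift_coeffs f) = lift_coeffs (fps_exp 1 oo f)"
  by (simp add: exp_series_def lift_coeffs_compose)

lemma exp_series_compose:
  assumes "fps_nth F 0 = 0" "fps_nth L 0 = 0"
  shows "exp_series (F oo L) = exp_series F oo L"
  by (simp add: exp_series_def fps_compose_assoc assms)


section \<open>The series of arcsin\<close>

text \<open>The derivative of arcsin (x/2) is 1 / sqrt (4 - x^2). Squaring avoids the square root of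
  a series, and the value 1/2 at 0 fixes the sign.\<close>

lemma arcsin_half_deriv:
  "(4 - fps_X\<^sup>2) * (fps_deriv arcsin_half)\<^sup>2 = 1" (is ?ode)
  "fps_nth arcsin_half 1 = 1 / 2"
proof -
  \<comment> \<open>The analytic expansion lives over the reals; \<open>emb\<close> is an injective
    ring homomorphism commuting with derivatives, so the equation can be pulled back.\<close>
  define emb :: "rat fps \<Rightarrow> real fps" where "emb f = Abs_fps (\<lambda>n. of_rat (fps_nth f n))" for f
  have emb_mult: "emb (f * g) = emb f * emb g" for f g
    by (simp add: emb_def fps_eq_iff fps_mult_nth of_rat_sum of_rat_mult)
  have emb_diff: "emb (f - g) = emb f - emb g" for f g
    by (simp add: emb_def fps_eq_iff of_rat_diff)
  have emb_1: "emb 1 = 1" and emb_X: "emb fps_X = fps_X"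
    by (simp_all add: emb_def fps_eq_iff)
  have emb_4: "emb 4 = fps_const 4"
    by (auto simp: emb_def fps_eq_iff fps_numeral_nth)
  have emb_deriv: "emb (fps_deriv f) = fps_deriv (emb f)" for f
    by (simp add: emb_def fps_eq_iff of_rat_mult of_rat_add)
  let ?f = "\<lambda>x::real. arcsin (x / 2)"
  have f: "deriv ?f has_fps_expansion fps_deriv (emb arcsin_half)"
    unfolding emb_def by (rule has_fps_expansion_deriv[OF arcsin_half_expansion])
  have deriv_f: "deriv ?f x = inverse (sqrt (1 - (x / 2)\<^sup>2)) / 2" if "\<bar>x\<bar> < 1" for x
  proof (rule DERIV_imp_deriv)
    have "(arcsin has_field_derivative inverse (sqrt (1 - (x / 2)\<^sup>2))) (at (x / 2))"
      by (rule DERIV_arcsin) (use that in simp_all)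
    moreover have "((\<lambda>x. x / 2) has_field_derivative 1 / 2) (at x)"
      by (auto intro!: derivative_eq_intros)
    ultimately show "(?f has_field_derivative inverse (sqrt (1 - (x / 2)\<^sup>2)) / 2) (at x)"
      using DERIV_chain2 by fastforce
  qed
  have ode: "(4 - x * x) * (deriv ?f x * deriv ?f x) = 1" if x: "\<bar>x\<bar> < 1" for x
  proof -
    have "1 - (x / 2)\<^sup>2 > 0"
      using x abs_square_less_1[of x] by (simp add: power_divide)
    then have "(1 - (x / 2)\<^sup>2) * (inverse (sqrt (1 - (x / 2)\<^sup>2)))\<^sup>2 = 1"
      by (simp add: power_inverse)
    then have "(1 - (x / 2)\<^sup>2) * (2 * deriv ?f x)\<^sup>2 = 1"
      by (simp only: deriv_f[OF x]) simp
    then show ?thesis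
      by (simp add: power2_eq_square algebra_simps)
  qed
  have "(\<lambda>x. (4 - x * x) * (deriv ?f x * deriv ?f x)) has_fps_expansion
      (fps_const 4 - fps_X * fps_X) * (fps_deriv (emb arcsin_half) * fps_deriv (emb arcsin_half))"
    by (intro has_fps_expansion_mult has_fps_expansion_diff f has_fps_expansion_fps_X
        has_fps_expansion_const)
  moreover have "\<forall>\<^sub>F x in nhds 0. (4 - x * x) * (deriv ?f x * deriv ?f x) = (1::real)"
    unfolding eventually_nhds_metric by (rule exI[of _ 1]) (use ode in \<open>simp add: dist_norm\<close>)
  ultimately have "(\<lambda>x::real. 1) has_fps_expansion
      (fps_const 4 - fps_X * fps_X) * (fps_deriv (emb arcsin_half) * fps_deriv (emb arcsin_half))"
    unfolding has_fps_expansion_def by (auto elim: eventually_elim2)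
  then have "(fps_const 4 - fps_X * fps_X) * (fps_deriv (emb arcsin_half) * fps_deriv (emb arcsin_half))
      = fps_const 1"
    by (rule has_fps_expansion_unique_real) (rule has_fps_expansion_const)
  then have "emb ((4 - fps_X\<^sup>2) * (fps_deriv arcsin_half)\<^sup>2) = emb 1"
    by (simp add: emb_mult emb_diff emb_1 emb_X emb_4 emb_deriv power2_eq_square)
  moreover have "f = g" if "emb f = emb g" for f g
  proof (rule fps_ext)
    show "fps_nth f n = fps_nth g n" for n
      using arg_cong[OF that, of "\<lambda>h. fps_nth h n"] by (simp add: emb_def)
  qed
  ultimately show ?ode
    by blast
  have "eval_fps (fps_deriv (emb arcsin_half)) 0 = deriv ?f 0"
    using f unfolding has_fps_expansion_def by (blast dest: eventually_nhds_x_imp_x)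
  then have "fps_nth (fps_deriv (emb arcsin_half)) 0 = deriv ?f 0"
    by (simp only: eval_fps_at_0)
  also have "\<dots> = 1 / 2"
    using deriv_f[of 0] by simp
  finally have "of_rat (fps_nth arcsin_half 1) = (of_rat (1 / 2) :: real)"
    by (simp add: emb_def of_rat_divide)
  then show "fps_nth arcsin_half 1 = 1 / 2"
    by (simp only: of_rat_eq_iff)
qed

lemma sin_compose_arcsin_half: "2 * (fps_sin 1 oo arcsin_half) = fps_X"
proof -
  \<comment> \<open>\<open>X\<close> and \<open>D = (4 - X\<^sup>2) a\<close> solve the same linear system as \<open>2 sin\<close> and \<open>2 cos\<close> of \<open>arcsin (X/2)\<close>.\<close>
  define a where "a = fps_deriv arcsin_half"
  define s where "s = fps_X - 2 * (fps_sin 1 oo arcsin_half)"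
  define D where "D = (4 - fps_X\<^sup>2) * a"
  define c where "c = D - 2 * (fps_cos 1 oo arcsin_half)"
  have cos_deriv: "fps_deriv (fps_cos 1) = - fps_sin (1::rat)"
    by (simp add: fps_cos_deriv flip: fps_const_neg)
  note comp = arcsin_half_nth_0 fps_compose_deriv fps_sin_deriv cos_deriv
  have Da: "D * a = 1"
    using arcsin_half_deriv(1) by (simp add: D_def a_def power2_eq_square mult.assoc)
  \<comment> \<open>As \<open>D * a = 1\<close>, \<open>D\<close> is a square root of 4 - X^2;
    differentiating its square gives its derivative.\<close>
  have "D * D = (4 - fps_X\<^sup>2) * (D * a)"
    by (simp only: D_def ac_simps)
  then have "D * D = 4 - fps_X\<^sup>2"
    by (simp only: Da mult_1_right)
  then have "fps_deriv (D * D) = fps_deriv (4 - fps_X\<^sup>2)" by simp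
  then have "2 * (D * fps_deriv D) = 2 * (- fps_X)"
    by (simp add: power2_eq_square)
  then have "D * fps_deriv D = - fps_X"
    by (simp only: mult_cancel_left) auto
  moreover have "fps_deriv D = (D * fps_deriv D) * a"
    by (simp only: mult.assoc mult.left_commute[of D] Da mult_1_right)
  ultimately have D': "fps_deriv D = - fps_X * a"
    by simp
  have s': "fps_deriv s = a * c"
    using Da by (simp add: s_def c_def comp a_def[symmetric] algebra_simps)
  have c': "fps_deriv c = - (a * s)"
    using D' by (simp add: s_def c_def comp a_def[symmetric] fps_compose_uminus algebra_simps)
  \<comment> \<open>Each of \<open>s\<close> and \<open>c\<close> drives the other's recursion,
    hence one joint induction.\<close>
  have "fps_nth s n = 0 \<and> fps_nth c n = 0" for n
  proof (induction n rule: less_induct)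
    case (less n)
    show ?case
    proof (cases n)
      case 0
      have "fps_nth a 0 = 1 / 2" using arcsin_half_deriv(2) by (simp add: a_def)
      then show ?thesis using 0 by (simp add: s_def c_def D_def fps_mult_nth)
    next
      case (Suc m)
      have "of_nat (Suc m) * fps_nth s (Suc m) = fps_nth (a * c) m"
        by (simp flip: s')
      moreover have "fps_nth (a * c) m = 0"
        unfolding fps_mult_nth using less Suc by (intro sum.neutral) auto
      moreover have "of_nat (Suc m) * fps_nth c (Suc m) = fps_nth (- (a * s)) m"
        by (simp flip: c')
      moreover have "fps_nth (a * s) m = 0"
        unfolding fps_mult_nth using less Suc by (intro sum.neutral) auto
      ultimately show ?thesis
        using Suc by (simp del: of_nat_Suc)
    qed
  qed
  then have "s = 0" by (simp add: fps_eq_iff)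
  then show ?thesis by (simp add: s_def)
qed

text \<open>This is X = 2 sin (Y/2) for Y = 2 arcsin (X/2): doubling the inner series compensates
  the frequency 1/2.\<close>

lemma two_sin_half_compose: "(2 * fps_sin (1/2)) oo (2 * arcsin_half) = fps_X"
proof -
  have "fps_sin (1/2 :: rat) oo (fps_const 2 * fps_X) = fps_sin 1"
    by (simp add: fps_compose_linear fps_eq_iff fps_sin_def power_one_over)
  moreover have "2 * arcsin_half = (fps_const 2 * fps_X) oo arcsin_half"
    by (simp add: fps_compose_mult_distrib arcsin_half_nth_0 numeral_fps_const)
  ultimately have "fps_sin (1/2) oo (2 * arcsin_half) = fps_sin 1 oo arcsin_half"
    by (simp add: fps_compose_assoc arcsin_half_nth_0)
  then show ?thesis
    using sin_compose_arcsin_half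
    by (simp add: fps_compose_mult_distrib fps_mult_nth arcsin_half_nth_0)
qed

text \<open>The half-angle formula; with X = 2 sin (Y/2) it yields X^2 = 2 - 2 cos Y.\<close>

lemma two_minus_two_cos: "2 - 2 * fps_cos 1 = (2 * fps_sin (1/2 :: rat))\<^sup>2"
proof -
  have "fps_cos (1/2 + 1/2 :: rat) = (fps_cos (1/2))\<^sup>2 - (fps_sin (1/2))\<^sup>2"
    unfolding fps_cos_add by (simp add: power2_eq_square)
  moreover have "(fps_cos (1/2 :: rat))\<^sup>2 + (fps_sin (1/2))\<^sup>2 = 1"
    by (rule fps_sin_cos_sum_of_squares)
  ultimately show ?thesis
    by (simp add: power_mult_distrib algebra_simps) algebra
qed


section \<open>The constant terms of the Eisenstein series\<close>

text \<open>\<open>b\<close> is t / (e^t - 1) + t/2 = (t/2) coth (t/2), here cleared of the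
  denominator.\<close>

lemma bernoulli_number_identity:
  fixes b :: "rat fps"
  defines "b \<equiv> Abs_fps (\<lambda>n. bernoulli_number n / fact n) + fps_const (1/2) * fps_X"
  shows "b * (fps_exp (1/2) - fps_exp (-1/2)) = fps_const (1/2) * fps_X * (fps_exp (1/2) + fps_exp (-1/2))"
proof -
  define h h' :: "rat fps" where "h = fps_exp (1/2)" and "h' = fps_exp (-1/2)"
  define Q :: "rat fps" where "Q = Abs_fps (\<lambda>n. bernoulli_number n / fact n)"
  have hh': "h * h' = 1"
    unfolding h_def h'_def fps_exp_add_mult[symmetric] by simp
  have hh: "h * h = fps_exp 1"
    unfolding h_def fps_exp_add_mult[symmetric] by simp
  have sd: "subdegree (fps_exp 1 - 1 :: rat fps) = 1"
    by (rule subdegreeI) auto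
  then have nz: "fps_exp 1 - 1 \<noteq> (0 :: rat fps)"
    by (metis subdegree_0 zero_neq_one)
  have "Q = fps_X / (fps_exp 1 - 1)"
    by (simp add: Q_def bernoulli_number_def fps_eq_iff)
  moreover have "fps_X / (fps_exp 1 - 1) * (fps_exp 1 - 1) = (fps_X :: rat fps)"
    by (rule fps_times_divide_eq) (use nz sd in auto)
  ultimately have "Q * (h * h - 1) = fps_X"
    by (simp only: hh)
  \<comment> \<open>Multiplication by e^(-t/2) turns e^t - 1 into e^(t/2) - e^(-t/2).\<close>
  moreover have "h - h' = (h * h - 1) * h'"
    by (simp add: left_diff_distrib mult.assoc hh')
  ultimately have 1: "Q * (h - h') = fps_X * h'"
    by (simp only: mult.assoc[symmetric])
  have half: "fps_const (1/2) + fps_const (1/2) = (1 :: rat fps)"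
    by simp
  have "(Q + fps_const (1/2) * fps_X) * (h - h') = fps_X * h' + fps_const (1/2) * fps_X * (h - h')"
    by (simp only: distrib_right 1)
  also have "fps_X * h' = (fps_const (1/2) + fps_const (1/2)) * (fps_X * h')"
    by (simp only: half mult_1_left)
  also have "\<dots> + fps_const (1/2) * fps_X * (h - h') = fps_const (1/2) * fps_X * (h + h')"
    by (simp only: algebra_simps)
  finally show ?thesis
    unfolding b_def Q_def h_def h'_def .
qed

text \<open>Rational stand-in for the substitution \<open>t = \<i>Y\<close>, which needs complex coefficients:
  on even series it is that substitution, on odd series it is off by the factor \<open>\<i>\<close>.\<close>

definition imag_twist :: "rat fps \<Rightarrow> rat fps" where
  "imag_twist f = Abs_fps (\<lambda>n. (-1) ^ (n div 2) * fps_nth f n)"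

text \<open>\<open>n div 2\<close> splits additively along \<open>n = i + (n - i)\<close> unless
  both parts are odd, and the evenness of \<open>f\<close> discards odd \<open>i\<close>.\<close>

lemma imag_twist_mult:
  assumes "\<And>n. odd n \<Longrightarrow> fps_nth f n = 0"
  shows "imag_twist (f * g) = imag_twist f * imag_twist g"
proof (rule fps_ext)
  fix n
  have "(-1) ^ (n div 2) * (fps_nth f i * fps_nth g (n - i)) =
      (-1) ^ (i div 2) * fps_nth f i * ((-1) ^ ((n - i) div 2) * fps_nth g (n - i))"
    if "i \<le> n" for i
  proof (cases "even i")
    case True
    then have "n div 2 = i div 2 + (n - i) div 2"
      using that by presburger
    then show ?thesis by (simp add: power_add)
  qed (simp add: assms)
  then show "fps_nth (imag_twist (f * g)) n = fps_nth (imag_twist f * imag_twist g) n"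
    unfolding imag_twist_def fps_nth_Abs_fps fps_mult_nth sum_distrib_left
    by (intro sum.cong) simp_all
qed

text \<open>The series of \<open>log (sin (Y/2) / (Y/2))\<close>, see \<open>exp_log_sinc\<close>.\<close>

definition log_sinc :: "rat fps" where
  "log_sinc = Abs_fps (\<lambda>k. if even k \<and> k \<ge> 2
     then (-1) ^ (k div 2) * bernoulli_number k / (of_nat k * fact k) else 0)"

text \<open>1 + Y \<open>log_sinc\<close>' is (Y/2) cot (Y/2), the twist of (t/2) coth (t/2); the
  denominator is cleared again.\<close>

lemma one_plus_X_log_sinc_deriv:
  "(1 + fps_X * fps_deriv log_sinc) * (2 * fps_sin (1/2)) = fps_X * fps_cos (1/2)"
proof -
  define h h' :: "rat fps" where "h = fps_exp (1/2)" and "h' = fps_exp (-1/2)"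
  define b :: "rat fps" where
    "b = Abs_fps (\<lambda>n. bernoulli_number n / fact n) + fps_const (1/2) * fps_X"
  have b: "b * (h - h') = fps_const (1/2) * fps_X * (h + h')"
    unfolding b_def h_def h'_def by (rule bernoulli_number_identity)
  have nz: "h - h' \<noteq> 0"
    by (auto simp: h_def h'_def)
  \<comment> \<open>Changing the sign of t exchanges \<open>h\<close> and \<open>h'\<close>, so
    \<open>b\<close> is even: B_1 = -1/2, and the later odd Bernoulli numbers vanish.\<close>
  have "h oo - fps_X = h'" "h' oo - fps_X = h"
    by (simp_all add: h_def h'_def)
  then have "(b oo - fps_X) * (h' - h) = - (fps_const (1/2) * fps_X) * (h' + h)"
    using arg_cong[OF b, of "\<lambda>f. f oo - fps_X"]
    by (simp add: fps_compose_mult_distrib fps_compose_sub_distrib fps_compose_add_distrib)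
  with b have "((b oo - fps_X) - b) * (h - h') = 0"
    by (simp add: algebra_simps)
  with nz have "b oo - fps_X = b" by simp
  then have odd_b: "fps_nth b n = 0" if "odd n" for n
  proof -
    have "fps_nth (b oo - fps_X) n = - fps_nth b n"
      using that by (simp add: fps_compose_uminus')
    then show ?thesis
      using \<open>b oo - fps_X = b\<close> by simp
  qed
  have b0: "fps_nth b 0 = 1"
    using arg_cong[OF b, of "\<lambda>f. fps_nth f 1"] by (simp add: fps_mult_nth h_def h'_def)
  have tw_b: "imag_twist b = 1 + fps_X * fps_deriv log_sinc"
  proof (rule fps_ext)
    fix n
    show "fps_nth (imag_twist b) n = fps_nth (1 + fps_X * fps_deriv log_sinc) n"
    proof (cases "n < 2")
      case True
      then consider "n = 0" | "n = 1" by linarith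
      then show ?thesis
        using odd_b[of 1] b0 by cases (simp_all add: imag_twist_def log_sinc_def)
    next
      case False
      then show ?thesis
        using odd_b[of n]
        by (cases n) (auto simp: imag_twist_def log_sinc_def b_def simp del: of_nat_Suc fact_Suc)
    qed
  qed
  \<comment> \<open>The twist omits the factor i on odd series, so 2 sinh (t/2) becomes 2 sin
    (Y/2).\<close>
  have tw_sinh: "imag_twist (h - h') = 2 * fps_sin (1/2)"
  proof (rule fps_ext)
    show "fps_nth (imag_twist (h - h')) n = fps_nth (2 * fps_sin (1/2)) n" for n
      by (cases "even n") (auto simp: imag_twist_def h_def h'_def fps_sin_def power_minus_odd
          power_one_over numeral_fps_const elim!: oddE)
  qed
  have tw_cosh: "imag_twist (h + h') = 2 * fps_cos (1/2)"
  proof (rule fps_ext)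
    show "fps_nth (imag_twist (h + h')) n = fps_nth (2 * fps_cos (1/2)) n" for n
      by (cases "even n") (auto simp: imag_twist_def h_def h'_def fps_cos_def
          power_one_over numeral_fps_const mult.commute elim!: oddE)
  qed
  have tw_X: "imag_twist (fps_const (1/2) * fps_X) = fps_const (1/2) * fps_X"
    by (rule fps_ext) (simp add: imag_twist_def)
  \<comment> \<open>The factors are swapped to put the even one, \<open>h + h'\<close>, first as in
    \<open>imag_twist_mult\<close>.\<close>
  have "imag_twist (b * (h - h')) = imag_twist ((h + h') * (fps_const (1/2) * fps_X))"
    using b by (simp add: mult.commute)
  also have "\<dots> = imag_twist (h + h') * imag_twist (fps_const (1/2) * fps_X)"
    by (rule imag_twist_mult) (auto simp: h_def h'_def elim!: oddE)
  also have "imag_twist (b * (h - h')) = imag_twist b * imag_twist (h - h')"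
    by (rule imag_twist_mult) (rule odd_b)
  finally have "(1 + fps_X * fps_deriv log_sinc) * (2 * fps_sin (1/2))
      = 2 * fps_cos (1/2) * (fps_const (1/2) * fps_X)"
    by (simp only: tw_b tw_sinh tw_cosh tw_X)
  also have "\<dots> = (2 * fps_const (1/2)) * (fps_X * fps_cos (1/2))"
    by (simp only: ac_simps)
  also have "2 * fps_const (1/2) = (1 :: rat fps)"
    by (simp add: numeral_fps_const)
  finally show ?thesis by simp
qed

text \<open>sin (Y/2) / (Y/2) and the exponential of \<open>log_sinc\<close> have the same
  logarithmic derivative and the value 1 at 0.\<close>

lemma exp_log_sinc: "(fps_exp 1 oo log_sinc) * fps_X = 2 * fps_sin (1/2)"
proof -
  define w :: "rat fps" where "w = fps_shift 1 (2 * fps_sin (1/2))"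
  have wX: "w * fps_X = 2 * fps_sin (1/2)"
    unfolding w_def by (rule fps_ext) (simp add: fps_mult_nth_0)
  have c: "2 * fps_const (1/2) = (1 :: rat fps)"
    by (simp add: numeral_fps_const)
  have "fps_deriv (w * fps_X) = (2 * fps_const (1/2)) * fps_cos (1/2)"
    by (simp add: wX fps_sin_deriv mult.assoc)
  then have d: "fps_X * fps_deriv w + w = fps_cos (1/2)"
    by (simp only: c) (simp add: algebra_simps)
  have "(1 + fps_X * fps_deriv log_sinc) * (w * fps_X) = fps_X * (fps_X * fps_deriv w + w)"
    unfolding d wX by (rule one_plus_X_log_sinc_deriv)
  then have "fps_X * (fps_X * fps_deriv w) = fps_X * (fps_X * (fps_deriv log_sinc * w))"
    by (simp add: algebra_simps)
  then have "fps_deriv w = fps_deriv log_sinc * w"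
    by (simp only: mult_cancel_left) simp
  moreover have "fps_deriv (fps_exp 1 oo log_sinc) = fps_deriv log_sinc * (fps_exp 1 oo log_sinc)"
    by (subst fps_compose_deriv) (simp_all add: log_sinc_def)
  moreover have "fps_nth w 0 = fps_nth (fps_exp 1 oo log_sinc) 0"
    by (simp add: w_def fps_mult_nth)
  ultimately have "w = fps_exp 1 oo log_sinc"
    by (rule fps_linear_ode_unique)
  then show ?thesis using wX by simp
qed

text \<open>At Y = 2 arcsin (X/2), the exponential of \<open>log_sinc\<close> is 2 sin (Y/2) / Y = X
  / Y.\<close>

lemma arcsin_factor_cancels:
  "(2 * arcsin_half / fps_X) * ((fps_exp 1 oo log_sinc) oo (2 * arcsin_half)) = 1"
proof -
  let ?y = "2 * arcsin_half" and ?u = "fps_exp 1 oo log_sinc"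
  have y0: "fps_nth ?y 0 = 0"
    by (simp add: fps_mult_nth arcsin_half_nth_0)
  have "?y / fps_X * fps_X = ?y"
    using y0 by (intro fps_ext) simp
  moreover have "(?y / fps_X * (?u oo ?y)) * fps_X = (?u oo ?y) * (?y / fps_X * fps_X)"
    by (simp only: ac_simps)
  moreover have "(?u oo ?y) * ?y = fps_X"
    using arg_cong[OF exp_log_sinc, of "\<lambda>f. f oo ?y"] y0 two_sin_half_compose
    by (simp add: fps_compose_mult_distrib)
  ultimately have "(?y / fps_X * (?u oo ?y)) * fps_X = 1 * fps_X"
    by (simp only: mult_1_left)
  then show ?thesis
    by (rule mult_right_cancel[THEN iffD1, rotated]) simp
qed


section \<open>The logarithm of a single factor\<close>

text \<open>Exchanges the two variables, because the q-coefficients of the derivative of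
  \<open>log_factor\<close> are plain sine series in Y.\<close>

definition slice :: "nat \<Rightarrow> rat fps fps \<Rightarrow> rat fps" where
  "slice N F = Abs_fps (\<lambda>k. fps_nth (fps_nth F k) N)"

lemma slice_eqI: "(\<And>N. slice N F = slice N G) \<Longrightarrow> F = G"
  by (simp add: slice_def fps_eq_iff)

lemma slice_add: "slice N (F + G) = slice N F + slice N G"
  and slice_diff: "slice N (F - G) = slice N F - slice N G"
  by (simp_all add: slice_def fps_eq_iff)

lemma slice_lift_mult: "slice N (lift_coeffs f * F) = f * slice N F"
  by (simp add: slice_def fps_eq_iff fps_mult_nth[of f] fps_mult_nth[of "lift_coeffs f"] fps_sum_nth)

lemma slice_q_power_mult:
  "slice N (fps_const (fps_X ^ m) * F) = (if N < m then 0 else slice (N - m) F)"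
  by (auto simp: slice_def fps_eq_iff fps_X_power_mult_nth)

definition macmahon_factor :: "nat \<Rightarrow> rat fps" where
  "macmahon_factor m = fps_X ^ m / (1 - fps_X ^ m)\<^sup>2"

text \<open>The logarithm of \<open>(1 - 2 cos Y q\<^sup>m + q\<^bsup>2m\<^esup>) / (1 - q\<^sup>m)\<^sup>2\<close>; here, and in \<open>divisor_log\<close> below,
  \<^const>\<open>fps_X\<close> stands for \<open>Y\<close>.\<close>

definition log_factor :: "nat \<Rightarrow> rat fps fps" where
  "log_factor m = Abs_fps (\<lambda>k. Abs_fps (\<lambda>N. if even k \<and> k \<ge> 2 \<and> N > 0 \<and> m dvd N
     then 2 * (-1) ^ (k div 2 - 1) * of_nat (N div m) ^ (k - 1) / fact k else 0))"

text \<open>As \<open>x\<close> is a frequency, this is a recurrence in n for sin (n Y), with the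
  coefficients 1, -2 cos Y, 1 of the polynomial 1 - 2 cos Y q^m + q^(2m).\<close>

lemma fps_sin_recurrence:
  fixes x :: "'a::field_char_0"
  shows "fps_sin (x + 1) - 2 * fps_cos 1 * fps_sin x + fps_sin (x - 1) = 0"
  using fps_sin_add[of x 1] fps_sin_add[of x "-1"]
  by (simp add: fps_sin_even fps_cos_odd algebra_simps)

lemma slice_log_factor_deriv:
  assumes "m > 0"
  shows "slice N (fps_deriv (log_factor m)) = (if m dvd N then 2 * fps_sin (of_nat (N div m)) else 0)"
proof (rule fps_ext)
  fix k
  have "fps_nth (slice N (fps_deriv (log_factor m))) k =
      of_nat (Suc k) * fps_nth (fps_nth (log_factor m) (Suc k)) N"
    by (simp add: slice_def del: of_nat_Suc flip: fps_of_nat)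
  also have "\<dots> = (if odd k \<and> N > 0 \<and> m dvd N
      then 2 * (-1) ^ (Suc k div 2 - 1) * of_nat (N div m) ^ k / fact k else 0)"
    by (auto simp: log_factor_def fact_Suc[of k] simp del: of_nat_Suc fact_Suc elim!: oddE)
  \<comment> \<open>At \<open>N = 0\<close> the sine has frequency 0 and vanishes, in accordance
    with the condition \<open>N > 0\<close>.\<close>
  also have "\<dots> = fps_nth (if m dvd N then 2 * fps_sin (of_nat (N div m)) else 0) k"
    by (auto simp: fps_sin_def numeral_fps_const elim!: oddE)
  finally show "fps_nth (slice N (fps_deriv (log_factor m))) k = \<dots>" .
qed

text \<open>Multiplying the sum of 2 sin (n Y) q^(mn) by 1 - 2 cos Y q^m + q^(2m) leaves only the
  term n = 1, by the sine recurrence.\<close>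

lemma log_factor_deriv_identity:
  assumes "m > 0"
  defines "Q \<equiv> fps_const (fps_X ^ m)"
  defines "D \<equiv> fps_deriv (log_factor m)"
  shows "D - lift_coeffs (2 * fps_cos 1) * (Q * D) + Q * (Q * D) = lift_coeffs (2 * fps_sin 1) * Q"
    (is "?l = ?r")
proof (rule slice_eqI)
  fix N
  have sD: "slice N' D = (if m dvd N' then 2 * fps_sin (of_nat (N' div m)) else 0)" for N'
    unfolding D_def using assms(1) by (rule slice_log_factor_deriv)
  have sQ: "slice N Q = (if N = m then 1 else 0)"
    by (auto simp: Q_def slice_def fps_eq_iff)
  have l: "slice N ?l = slice N D - 2 * fps_cos 1 * (if N < m then 0 else slice (N - m) D)
      + (if N < 2 * m then 0 else slice (N - 2 * m) D)"
  proof -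
    have "slice N (Q * D) = (if N < m then 0 else slice (N - m) D)"
      unfolding Q_def by (rule slice_q_power_mult)
    moreover have "slice N (Q * (Q * D)) = (if N < 2 * m then 0 else slice (N - 2 * m) D)"
      unfolding Q_def slice_q_power_mult by (auto simp: mult_2)
    ultimately show ?thesis
      by (simp only: slice_add slice_diff slice_lift_mult)
  qed
  have r: "slice N ?r = (if N = m then 2 * fps_sin 1 else 0)"
    by (simp add: slice_lift_mult sQ)
  show "slice N ?l = slice N ?r"
  proof (cases "m dvd N")
    case True
    then obtain n where N: "N = m * n" by blast
    \<comment> \<open>Only from \<open>n = 2\<close> on are both shifted terms in range;
      \<open>n = 1\<close> leaves 2 sin Y, the right-hand side.\<close>
    consider "n = 0" | "n = 1" | n' where "n = Suc (Suc n')"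
      by (metis One_nat_def not0_implies_Suc)
    then show ?thesis
    proof cases
      case 3
      have "N \<ge> 2 * m" "N \<noteq> m" "N - m = m * Suc n'" "N - 2 * m = m * n'"
        using assms(1) by (auto simp: N 3)
      then have "slice N ?l = 2 * (fps_sin (of_nat (Suc n') + 1)
          - 2 * fps_cos 1 * fps_sin (of_nat (Suc n')) + fps_sin (of_nat (Suc n') - 1))"
        using assms(1) unfolding l sD by (simp add: N 3 algebra_simps)
      also have "\<dots> = 0"
        by (simp only: fps_sin_recurrence mult_zero_right)
      finally show ?thesis
        using \<open>N \<noteq> m\<close> r by simp
    qed (use assms(1) in \<open>unfold l r sD, simp_all add: N\<close>)
  next
    case False
    then have "\<not> m dvd N - m" if "\<not> N < m"
      using that by (simp add: dvd_minus_self)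
    moreover have "\<not> m dvd N - 2 * m" if "\<not> N < 2 * m"
      using that False by (metis dvd_add_left_iff dvd_triv_right le_add_diff_inverse2 linorder_not_less)
    ultimately show ?thesis
      using False unfolding l r sD by auto
  qed
qed

lemma macmahon_factor_mult:
  assumes "m > 0"
  shows "macmahon_factor m * (1 - fps_X ^ m)\<^sup>2 = fps_X ^ m"
proof -
  have "fps_nth ((1 - fps_X ^ m)\<^sup>2 :: rat fps) 0 \<noteq> 0"
    using assms by (simp add: fps_power_zeroth power_0_left)
  then have "is_unit ((1 - fps_X ^ m)\<^sup>2 :: rat fps)"
    by (simp add: fps_is_unit_iff)
  then show ?thesis
    unfolding macmahon_factor_def by (rule unit_div_mult_self)
qed

text \<open>The derivative of the right-hand side is 2 sin Y times \<open>macmahon_factor m\<close>,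
  so the differential equation is the preceding identity divided by (1 - q^m)^2.\<close>

lemma exp_log_factor:
  assumes "m > 0"
  shows "exp_series (log_factor m) =
    1 + lift_coeffs (2 - 2 * fps_cos 1) * fps_const (macmahon_factor m)"
proof (rule exp_series_eqI)
  define Q where "Q = fps_const (fps_X ^ m :: rat fps)"
  define K where "K = fps_const ((1 - fps_X ^ m)\<^sup>2 :: rat fps)"
  define A where "A = fps_const (macmahon_factor m)"
  define D where "D = fps_deriv (log_factor m)"
  define C where "C = lift_coeffs (2 * fps_cos 1)"
  have AK: "A * K = Q"
    using macmahon_factor_mult[OF assms] by (simp add: A_def K_def Q_def)
  have K: "K = 1 - 2 * Q + Q * Q"
    by (simp add: K_def Q_def power2_eq_square algebra_simps numeral_fps_const)
  have cos: "lift_coeffs (2 - 2 * fps_cos 1) = 2 - C"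
    unfolding C_def lift_coeffs_diff by (simp add: numeral_fps_const lift_coeffs_const)
  have "K \<noteq> 0"
    using AK by (auto simp: Q_def)
  \<comment> \<open>\<open>K\<close> times \<open>1 + (2 - C) * A\<close> is 1 - 2 cos Y q^m +
    q^(2m), the multiplier in \<open>log_factor_deriv_identity\<close>.\<close>
  have "D * (1 + (2 - C) * A) * K = D * (K + (2 - C) * (A * K))"
    by (simp only: algebra_simps mult_1_left mult_1_right)
  also have "\<dots> = D * (K + (2 - C) * Q)"
    by (simp only: AK)
  also have "\<dots> = D - C * (Q * D) + Q * (Q * D)"
    by (simp add: K algebra_simps)
  also have "\<dots> = lift_coeffs (2 * fps_sin 1) * (A * K)"
    unfolding AK using log_factor_deriv_identity[OF assms] by (simp only: D_def C_def Q_def)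
  finally have "D * (1 + (2 - C) * A) * K = lift_coeffs (2 * fps_sin 1) * A * K"
    by (simp only: mult.assoc)
  with \<open>K \<noteq> 0\<close> have *: "D * (1 + (2 - C) * A) = lift_coeffs (2 * fps_sin 1) * A"
    by (simp only: mult_right_cancel not_False_eq_True)
  have "fps_deriv (2 - 2 * fps_cos 1) = (2 * fps_sin 1 :: rat fps)"
    by (simp add: fps_cos_deriv flip: fps_const_neg)
  then have "fps_deriv (1 + lift_coeffs (2 - 2 * fps_cos 1) * A) = lift_coeffs (2 * fps_sin 1) * A"
    by (simp add: A_def lift_coeffs_deriv)
  with * show "fps_deriv (1 + lift_coeffs (2 - 2 * fps_cos 1) * fps_const (macmahon_factor m)) =
      fps_deriv (log_factor m) * (1 + lift_coeffs (2 - 2 * fps_cos 1) * fps_const (macmahon_factor m))"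
    by (simp only: cos A_def D_def)
qed (auto simp: log_factor_def fps_eq_iff fps_mult_nth_0)


section \<open>Passing to infinite products\<close>

definition q_cong :: "nat \<Rightarrow> rat fps fps \<Rightarrow> rat fps fps \<Rightarrow> bool" where
  "q_cong M F G \<longleftrightarrow> (\<forall>k. \<forall>N\<le>M. fps_nth (fps_nth F k) N = fps_nth (fps_nth G k) N)"

lemma q_cong_refl [simp]: "q_cong M F F"
  by (simp add: q_cong_def)

lemma q_cong_eqI: "(\<And>M. q_cong M F G) \<Longrightarrow> F = G"
  unfolding q_cong_def by (intro fps_ext) blast

lemma q_cong_mult:
  assumes "q_cong M F F'" "q_cong M G G'"
  shows "q_cong M (F * G) (F' * G')"
  unfolding q_cong_def
proof (intro allI impI)
  fix k N assume "N \<le> M"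
  then have "fps_nth (fps_nth F i * fps_nth G j) N = fps_nth (fps_nth F' i * fps_nth G' j) N" for i j
    using assms unfolding q_cong_def fps_mult_nth by (intro sum.cong) auto
  then show "fps_nth (fps_nth (F * G) k) N = fps_nth (fps_nth (F' * G') k) N"
    by (simp only: fps_mult_nth[of F] fps_mult_nth[of F'] fps_sum_nth)
qed

lemma q_cong_power: "q_cong M F G \<Longrightarrow> q_cong M (F ^ n) (G ^ n)"
  by (induction n) (simp_all add: q_cong_mult)

lemma q_cong_compose:
  assumes "q_cong M F F'" "q_cong M G G'"
  shows "q_cong M (F oo G) (F' oo G')"
  unfolding q_cong_def
proof (intro allI impI)
  fix k N assume "N \<le> M"
  then have "fps_nth (fps_nth F i * fps_nth (G ^ i) k) N = fps_nth (fps_nth F' i * fps_nth (G' ^ i) k) N" for i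
    using assms q_cong_power[OF assms(2), of i] unfolding q_cong_def fps_mult_nth[of "fps_nth _ _"]
    by (intro sum.cong) auto
  then show "fps_nth (fps_nth (F oo G) k) N = fps_nth (fps_nth (F' oo G') k) N"
    by (simp only: fps_compose_nth fps_sum_nth)
qed

section \<open>The logarithm of the full product\<close>

text \<open>\<open>log_factor m\<close> has no terms below q^m, so cutting \<open>m\<close> off at
  \<open>N\<close> still yields the sum of \<open>log_factor m\<close> over all of \<open>S\<close>,
  even for infinite \<open>S\<close>.\<close>

definition divisor_log :: "nat set \<Rightarrow> rat fps fps" where
  "divisor_log S = Abs_fps (\<lambda>k. Abs_fps (\<lambda>N.
     \<Sum>m\<in>S \<inter> {1..N}. fps_nth (fps_nth (log_factor m) k) N))"

lemma q_cong_divisor_log: "q_cong M (divisor_log S) (\<Sum>m\<in>S \<inter> {1..M}. log_factor m)"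
  unfolding q_cong_def divisor_log_def fps_sum_nth fps_nth_Abs_fps
  by (intro allI impI sum.mono_neutral_left) (auto simp: log_factor_def dest: dvd_imp_le)

text \<open>Pairing each divisor \<open>m\<close> of \<open>N\<close> with
  \<open>n = N div m\<close> gives the divisor sums of the Eisenstein series, with \<open>m\<close>
  restricted to \<open>S\<close>.\<close>

lemma divisor_log_nth:
  assumes "S \<subseteq> {1..}" "j \<ge> 1"
  shows "fps_nth (divisor_log S) (2 * j) = fps_const ((-1) ^ (j - 1) / of_nat j * (1 / fact (2 * j - 1))) *
    (\<Sum>\<^sub>\<infinity>(m, n)\<in>S \<times> {1..}. of_nat (n ^ (2 * j - 1)) * fps_X ^ (m * n))"
proof (rule fps_ext)
  fix N
  define c :: rat where "c = (-1) ^ (j - 1) / of_nat j * (1 / fact (2 * j - 1))"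
  \<comment> \<open>Splits 2 / (2j)! into the 1/j of the exponent and the 1 / (2j - 1)! of the
    Eisenstein series.\<close>
  have "fact (2 * j) = (2 * of_nat j * fact (2 * j - 1) :: rat)"
    using assms(2) fact_reduce[of "2 * j", where ?'a = rat] by simp
  then have c: "2 * (-1) ^ (j - Suc 0) * x / fact (2 * j) = c * x" for x
    by (simp add: c_def)
  have sub: "S \<times> {1..} \<subseteq> {1..} \<times> {1..}"
    using assms(1) by auto
  have "fps_nth (fps_nth (divisor_log S) (2 * j)) N =
      (\<Sum>m\<in>{m \<in> S \<inter> {1..N}. m dvd N}. c * of_nat (N div m) ^ (2 * j - 1))"
    unfolding divisor_log_def fps_nth_Abs_fps log_factor_def
    using assms(2) by (intro sum.mono_neutral_cong_right) (auto simp: c)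
  also have "\<dots> = (\<Sum>(m, n) | (m, n) \<in> S \<times> {1..} \<and> m * n = N. c * of_nat (n ^ (2 * j - 1)))"
    using assms(1)
    by (intro sum.reindex_bij_witness[of _ fst "\<lambda>m. (m, N div m)"])
      (auto simp: Suc_le_eq dvd_imp_le div_greater_zero_iff)
  also have "\<dots> = c * (\<Sum>(m, n) | (m, n) \<in> S \<times> {1..} \<and> m * n = N. of_nat (n ^ (2 * j - 1)))"
    unfolding sum_distrib_left by (intro sum.cong) auto
  finally show "fps_nth (fps_nth (divisor_log S) (2 * j)) N =
      fps_nth (fps_const c *
        (\<Sum>\<^sub>\<infinity>(m, n)\<in>S \<times> {1..}. of_nat (n ^ (2 * j - 1)) * fps_X ^ (m * n))) N"
    by (simp only: fps_mult_left_const_nth eisenstein_sum_nth[OF sub])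
qed

lemma divisor_log_nth_eq_0: "\<not> (even k \<and> k \<ge> 2) \<Longrightarrow> fps_nth (divisor_log S) k = 0"
  by (rule fps_ext) (auto simp: divisor_log_def log_factor_def)

text \<open>\<open>L ^ (2 * j)\<close> has no terms below X^(2j), so each coefficient is a finite
  sum. In the form of a composition, the exponent becomes accessible to
  \<open>exp_series_compose\<close>.\<close>

lemma infsum_even_powers:
  fixes c :: "nat \<Rightarrow> 'b::comm_ring_1"
  assumes "fps_nth L 0 = 0"
  shows "(\<Sum>\<^sub>\<infinity>j\<in>{1..}. fps_const (c j) * L ^ (2 * j)) =
    Abs_fps (\<lambda>k. if even k \<and> k \<ge> 2 then c (k div 2) else 0) oo L"
proof (rule fps_ext)
  fix N :: nat
  let ?J = "{j \<in> {1..}. 2 * j \<le> N}"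
  have nz: "2 * j \<le> N" if "fps_nth (fps_const (c j) * L ^ (2 * j)) N \<noteq> 0" for j and N :: nat
    using that startsby_zero_power_prefix[OF assms, of "2 * j"]
    by (metis fps_mult_left_const_nth mult_zero_right not_le)
  have fin: "finite {j \<in> {1..}. fps_nth (fps_const (c j) * L ^ (2 * j)) N \<noteq> 0}" for N
    by (rule finite_subset[of _ "{..N}"]) (auto simp del: fps_mult_left_const_nth dest!: nz)
  have "fps_nth (\<Sum>\<^sub>\<infinity>j\<in>{1..}. fps_const (c j) * L ^ (2 * j)) N =
      (\<Sum>j | j \<in> {1..} \<and> fps_nth (fps_const (c j) * L ^ (2 * j)) N \<noteq> 0.
        fps_nth (fps_const (c j) * L ^ (2 * j)) N)"
    by (rule fps_nth_infsum[OF fin])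
  also have "\<dots> = (\<Sum>j\<in>?J. fps_nth (fps_const (c j) * L ^ (2 * j)) N)"
    using nz by (intro sum.mono_neutral_left finite_subset[of ?J "{..N}"]) auto
  also have "\<dots> = (\<Sum>i | i \<in> {0..N} \<and> even i \<and> i \<ge> 2. c (i div 2) * fps_nth (L ^ i) N)"
    by (rule sum.reindex_bij_witness[of _ "\<lambda>i. i div 2" "\<lambda>j. 2 * j"]) auto
  also have "\<dots> = fps_nth (Abs_fps (\<lambda>k. if even k \<and> k \<ge> 2 then c (k div 2) else 0) oo L) N"
    unfolding fps_compose_nth by (intro sum.mono_neutral_cong_left) auto
  finally show "fps_nth (\<Sum>\<^sub>\<infinity>j\<in>{1..}. fps_const (c j) * L ^ (2 * j)) N =
      fps_nth (Abs_fps (\<lambda>k. if even k \<and> k \<ge> 2 then c (k div 2) else 0) oo L) N" .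
qed

section \<open>MacMahon's series and their generating functions\<close>

lemma macmahon_term_eq_prod_list:
  assumes "\<forall>m\<in>set ms. m > 0"
  shows "macmahon_term ms = prod_list (map macmahon_factor ms)"
proof -
  let ?d = "\<lambda>m. (1 - fps_X ^ m)\<^sup>2 :: rat fps"
  have *: "fps_X ^ sum_list ms = prod_list (map macmahon_factor ms) * prod_list (map ?d ms)"
    using assms
  proof (induction ms)
    case (Cons m ms)
    then have "fps_X ^ m = macmahon_factor m * ?d m"
      by (simp add: macmahon_factor_mult)
    with Cons show ?case
      by (simp add: power_add ac_simps)
  qed simp
  have "prod_list (map ?d ms) \<noteq> 0"
    using * by auto
  then show ?thesis
    unfolding macmahon_term_def * by simp
qed

lemma macmahon_term_nth_eq_0:
  assumes "\<forall>m\<in>set ms. m > 0" "m \<in> set ms" "m > N"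
  shows "fps_nth (macmahon_term ms) N = 0"
proof -
  have "is_unit ((1 - fps_X ^ m)\<^sup>2 :: rat fps)"
    using assms by (simp add: fps_is_unit_iff fps_power_zeroth power_0_left)
  then have "fps_X ^ m dvd macmahon_factor m"
    using macmahon_factor_mult[of m] assms by (metis dvd_mult_unit_iff dvd_refl)
  also have "macmahon_factor m dvd prod_list (map macmahon_factor ms)"
    using assms(2) by (intro prod_list_dvd) auto
  finally obtain f where "macmahon_term ms = fps_X ^ m * f"
    using assms(1) by (auto simp: macmahon_term_eq_prod_list)
  then show ?thesis
    using assms(3) by (simp add: fps_X_power_mult_nth)
qed

text \<open>Treats both cases at once: all positive integers as \<open>S\<close> give A_r, the odd
  ones give C_r.\<close>

definition macmahon_sum :: "nat set \<Rightarrow> nat \<Rightarrow> rat fps" where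
  "macmahon_sum S r = (\<Sum>\<^sub>\<infinity>ms\<in>{ms \<in> decreasing_tuples r. set ms \<subseteq> S}. macmahon_term ms)"

text \<open>A decreasing tuple is determined by its set of entries, and tuples with an entry above
  \<open>N\<close> do not reach q^N.\<close>

lemma macmahon_sum_nth:
  assumes "S \<subseteq> {1..}" "N \<le> M"
  shows "fps_nth (macmahon_sum S r) N =
    (\<Sum>T | T \<subseteq> S \<inter> {1..M} \<and> card T = r. fps_nth (prod macmahon_factor T) N)"
proof -
  let ?A = "{ms \<in> decreasing_tuples r. set ms \<subseteq> S}"
  let ?B = "{ms \<in> decreasing_tuples r. set ms \<subseteq> S \<inter> {1..M}}"
  have fin: "finite {ms \<in> ?A. fps_nth (macmahon_term ms) N \<noteq> 0}" for N
    by (rule finite_subset[OF _ macmahon_finite[of r N]]) auto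
  have finB: "finite ?B"
    by (rule finite_subset[OF _ finite_lists_length_eq[of "{1..M}" r]])
      (auto simp: decreasing_tuples_def)
  have "fps_nth (macmahon_sum S r) N =
      (\<Sum>ms | ms \<in> ?A \<and> fps_nth (macmahon_term ms) N \<noteq> 0. fps_nth (macmahon_term ms) N)"
    unfolding macmahon_sum_def by (rule fps_nth_infsum[OF fin])
  also have "\<dots> = (\<Sum>ms\<in>?B. fps_nth (macmahon_term ms) N)"
  proof (rule sum.mono_neutral_left[OF finB])
    show "{ms \<in> ?A. fps_nth (macmahon_term ms) N \<noteq> 0} \<subseteq> ?B"
    proof safe
      fix ms m assume ms: "ms \<in> decreasing_tuples r" "fps_nth (macmahon_term ms) N \<noteq> 0" "m \<in> set ms"
      then have pos: "\<forall>m\<in>set ms. m > 0"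
        by (simp add: decreasing_tuples_def)
      with ms have "m \<le> N"
        using macmahon_term_nth_eq_0[of ms m N] not_le by blast
      with assms(2) pos ms(3) show "m \<in> {1..M}"
        by (simp add: Suc_le_eq)
    qed auto
  qed auto
  also have "\<dots> = (\<Sum>T | T \<subseteq> S \<inter> {1..M} \<and> card T = r. fps_nth (prod macmahon_factor T) N)"
  proof (rule sum.reindex_bij_witness[of _ "\<lambda>T. rev (sorted_list_of_set T)" set])
    fix ms assume "ms \<in> ?B"
    then have ms: "length ms = r" "sorted_wrt (<) (rev ms)" "\<forall>m\<in>set ms. m > 0" "set ms \<subseteq> S \<inter> {1..M}"
      by (auto simp: decreasing_tuples_def sorted_wrt_rev)
    have "sorted_list_of_set (set (rev ms)) = rev ms"
      using ms(2) by (intro sorted_list_of_set.idem_if_sorted_distinct)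
        (auto simp: strict_sorted_iff simp del: distinct_rev)
    then show "rev (sorted_list_of_set (set ms)) = ms"
      by simp
    have dist: "distinct ms"
      using ms(2) by (simp add: strict_sorted_iff)
    then show "set ms \<in> {T. T \<subseteq> S \<inter> {1..M} \<and> card T = r}"
      using ms by (simp add: distinct_card)
    show "fps_nth (prod macmahon_factor (set ms)) N = fps_nth (macmahon_term ms) N"
      using dist ms(3) by (simp add: macmahon_term_eq_prod_list prod.distinct_set_conv_list)
  next
    fix T assume T: "T \<in> {T. T \<subseteq> S \<inter> {1..M} \<and> card T = r}"
    then have "finite T"
      by (auto intro: finite_subset)
    with T show "set (rev (sorted_list_of_set T)) = T" "rev (sorted_list_of_set T) \<in> ?B"
      by (auto simp: decreasing_tuples_def sorted_wrt_rev)
  qed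
  finally show ?thesis .
qed

definition macmahon_series :: "nat set \<Rightarrow> rat fps fps" where
  "macmahon_series S = 1 + (\<Sum>\<^sub>\<infinity>r\<in>{1..}. fps_const (macmahon_sum S r) * fps_X ^ (2 * r))"

text \<open>Only the empty tuple occurs, so the leading 1 of \<open>macmahon_series\<close> is its
  term r = 0.\<close>

lemma macmahon_sum_0: "macmahon_sum S 0 = 1"
proof -
  have "{ms \<in> decreasing_tuples 0. set ms \<subseteq> S} = {[]}"
    by (auto simp: decreasing_tuples_def)
  then show ?thesis by (simp add: macmahon_sum_def macmahon_term_def)
qed

lemma macmahon_series_nth:
  "fps_nth (macmahon_series S) k = (if even k then macmahon_sum S (k div 2) else 0)"
proof -
  have "fps_nth (macmahon_series S) k = fps_nth 1 k + (if even k \<and> k \<ge> 2 then macmahon_sum S (k div 2) else 0)"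
    unfolding macmahon_series_def by (subst infsum_even_powers) simp_all
  then show ?thesis
    by (auto simp: macmahon_sum_0 elim!: evenE)
qed

text \<open>Expanding the product over subsets \<open>T\<close> makes the coefficient of X^(2r) the
  elementary symmetric function of degree r in the \<open>macmahon_factor m\<close>.\<close>

lemma q_cong_macmahon_series:
  assumes "S \<subseteq> {1..}"
  shows "q_cong M (macmahon_series S)
    (\<Prod>m\<in>S \<inter> {1..M}. 1 + fps_X\<^sup>2 * fps_const (macmahon_factor m))"
proof -
  let ?U = "S \<inter> {1..M}"
  have const_prod: "(\<Prod>m\<in>T. fps_const (macmahon_factor m)) = fps_const (prod macmahon_factor T)" for T
    by (induction T rule: infinite_finite_induct) auto
  have "(\<Prod>m\<in>?U. fps_X\<^sup>2 * fps_const (macmahon_factor m) + 1) =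
      (\<Sum>T\<in>Pow ?U. (\<Prod>m\<in>T. fps_X\<^sup>2 * fps_const (macmahon_factor m)) * (\<Prod>m\<in>?U - T. 1))"
    by (rule prod_add) simp
  also have "\<dots> = (\<Sum>T\<in>Pow ?U. fps_X ^ (2 * card T) * fps_const (prod macmahon_factor T))"
    by (intro sum.cong) (simp_all add: prod.distrib const_prod power_mult)
  finally have prod: "(\<Prod>m\<in>?U. 1 + fps_X\<^sup>2 * fps_const (macmahon_factor m)) =
      (\<Sum>T\<in>Pow ?U. fps_X ^ (2 * card T) * fps_const (prod macmahon_factor T))"
    by (simp add: add.commute)
  show ?thesis
    unfolding q_cong_def
  proof (intro allI impI)
    fix k N assume N: "N \<le> M"
    have "fps_nth (fps_nth (\<Prod>m\<in>?U. 1 + fps_X\<^sup>2 * fps_const (macmahon_factor m)) k) N =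
        (\<Sum>T\<in>Pow ?U. if k = 2 * card T then fps_nth (prod macmahon_factor T) N else 0)"
      unfolding prod fps_sum_nth fps_X_power_mult_nth by (intro sum.cong) auto
    also have "\<dots> = (\<Sum>T | T \<subseteq> ?U \<and> k = 2 * card T. fps_nth (prod macmahon_factor T) N)"
      by (intro sum.mono_neutral_cong_right) auto
    also have "\<dots> = fps_nth (fps_nth (macmahon_series S) k) N"
    proof (cases "even k")
      case True
      then have "{T. T \<subseteq> ?U \<and> k = 2 * card T} = {T. T \<subseteq> ?U \<and> card T = k div 2}"
        by auto
      then show ?thesis
        using True by (simp only: macmahon_series_nth macmahon_sum_nth[OF assms N] if_True)
    next
      case False
      then have "{T. T \<subseteq> ?U \<and> k = 2 * card T} = {}"
        by auto
      then show ?thesis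
        using False by (simp only: macmahon_series_nth) simp
    qed
    finally show "fps_nth (fps_nth (macmahon_series S) k) N =
        fps_nth (fps_nth (\<Prod>m\<in>?U. 1 + fps_X\<^sup>2 * fps_const (macmahon_factor m)) k) N" ..
  qed
qed

text \<open>The common core of both identities: modulo q^(M+1) the series is a finite product whose
  factors are exponentials of \<open>log_factor m\<close> at Y = 2 arcsin (X/2).\<close>

lemma macmahon_series_eq_exp:
  assumes "S \<subseteq> {1..}"
  defines "L \<equiv> lift_coeffs (2 * arcsin_half)"
  shows "macmahon_series S = exp_series (divisor_log S) oo L"
proof (rule q_cong_eqI)
  fix M
  have L0: "fps_nth L 0 = 0"
    unfolding L_def by (rule lift_arcsin_half_nth_0)
  have y0: "fps_nth (2 * arcsin_half) 0 = 0"
    by (simp add: fps_mult_nth_0 arcsin_half_nth_0)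
  have "(2 - 2 * fps_cos 1) oo (2 * arcsin_half) = fps_X\<^sup>2"
    by (simp only: two_minus_two_cos two_sin_half_compose flip: fps_compose_power[OF y0])
  then have "lift_coeffs (2 - 2 * fps_cos 1) oo L = fps_X\<^sup>2"
    by (simp only: L_def lift_coeffs_compose lift_coeffs_power lift_coeffs_X)
  then have factor: "exp_series (log_factor m) oo L = 1 + fps_X\<^sup>2 * fps_const (macmahon_factor m)"
    if "m > 0" for m
    by (simp add: exp_log_factor[OF that] fps_compose_add_distrib fps_compose_mult_distrib[OF L0])
  let ?U = "S \<inter> {1..M}"
  have "(\<Prod>m\<in>?U. 1 + fps_X\<^sup>2 * fps_const (macmahon_factor m)) =
      (\<Prod>m\<in>?U. exp_series (log_factor m) oo L)"
    by (intro prod.cong) (auto simp: factor)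
  also have "\<dots> = exp_series (\<Sum>m\<in>?U. log_factor m) oo L"
    by (subst exp_series_sum) (auto simp: fps_compose_prod_distrib[OF L0] log_factor_def fps_eq_iff)
  finally have "q_cong M (macmahon_series S) (exp_series (\<Sum>m\<in>?U. log_factor m) oo L)"
    using q_cong_macmahon_series[OF assms(1), of M] by simp
  moreover have "q_cong M (exp_series (divisor_log S) oo L) (exp_series (\<Sum>m\<in>?U. log_factor m) oo L)"
    unfolding exp_series_def by (intro q_cong_compose q_cong_divisor_log q_cong_refl)
  ultimately show "q_cong M (macmahon_series S) (exp_series (divisor_log S) oo L)"
    by (simp add: q_cong_def)
qed

theorem theorem1p1:
  shows "1 + (\<Sum>\<^sub>\<infinity>r\<in>{1..}. fps_const (macmahon_A r) * fps_X ^ (2 * r)) =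
      lift_coeffs (2 * arcsin_half / fps_X) *
      exp_series (\<Sum>\<^sub>\<infinity>j\<in>{1..}. fps_const (fps_const ((-1) ^ (j - 1) / of_nat j) * eisenstein (2 * j)) *
        lift_coeffs (2 * arcsin_half) ^ (2 * j))
    \<and> 1 + (\<Sum>\<^sub>\<infinity>r\<in>{1..}. fps_const (macmahon_C r) * fps_X ^ (2 * r)) =
      exp_series (\<Sum>\<^sub>\<infinity>j\<in>{1..}. fps_const (fps_const ((-1) ^ (j - 1) / of_nat j) * eisenstein_odd (2 * j)) *
        lift_coeffs (2 * arcsin_half) ^ (2 * j))"
proof
  define y where "y = 2 * arcsin_half"
  define L where "L = lift_coeffs y"
  have y0: "fps_nth y 0 = 0"
    by (simp add: y_def fps_mult_nth_0 arcsin_half_nth_0)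
  have L0: "fps_nth L 0 = 0"
    by (simp add: L_def y0)
  have div0: "fps_nth (divisor_log S) 0 = 0" for S
    by (simp add: divisor_log_nth_eq_0)
  have sinc0: "fps_nth log_sinc 0 = 0"
    by (simp add: log_sinc_def)

  \<comment> \<open>Second identity: the odd Eisenstein series have no constant term, so
    \<open>divisor_log\<close> accounts for the whole exponent.\<close>
  have odd_sub: "{m. odd m} \<subseteq> {1::nat..}"
    by (auto simp: odd_pos Suc_le_eq)
  have odd_nth: "fps_const ((-1) ^ (j - 1) / of_nat j) * eisenstein_odd (2 * j) =
      fps_nth (divisor_log {m. odd m}) (2 * j)" if "j \<ge> 1" for j
    using that
    by (subst divisor_log_nth[OF odd_sub])
      (auto simp: eisenstein_odd_altdef simp flip: fps_const_mult simp del: of_nat_power)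
  have "Abs_fps (\<lambda>k. if even k \<and> k \<ge> 2
      then fps_const ((-1) ^ (k div 2 - 1) / of_nat (k div 2)) * eisenstein_odd (2 * (k div 2)) else 0)
      = divisor_log {m. odd m}"
  proof (rule fps_ext)
    show "fps_nth (Abs_fps (\<lambda>k. if even k \<and> k \<ge> 2
        then fps_const ((-1) ^ (k div 2 - 1) / of_nat (k div 2)) * eisenstein_odd (2 * (k div 2)) else 0)) k
        = fps_nth (divisor_log {m. odd m}) k" for k
      using odd_nth[of "k div 2"] by (auto simp: divisor_log_nth_eq_0)
  qed
  then have "(\<Sum>\<^sub>\<infinity>j\<in>{1..}. fps_const (fps_const ((-1) ^ (j - 1) / of_nat j) * eisenstein_odd (2 * j)) *
      L ^ (2 * j)) = divisor_log {m. odd m} oo L"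
    by (simp only: infsum_even_powers[OF L0])
  moreover have "macmahon_C r = macmahon_sum {m. odd m} r" for r
    unfolding macmahon_C_def macmahon_sum_def by (intro infsum_cong_neutral) auto
  ultimately show "1 + (\<Sum>\<^sub>\<infinity>r\<in>{1..}. fps_const (macmahon_C r) * fps_X ^ (2 * r)) =
      exp_series (\<Sum>\<^sub>\<infinity>j\<in>{1..}. fps_const (fps_const ((-1) ^ (j - 1) / of_nat j) * eisenstein_odd (2 * j)) *
        lift_coeffs (2 * arcsin_half) ^ (2 * j))"
    using macmahon_series_eq_exp[OF odd_sub]
    by (simp add: macmahon_series_def exp_series_compose[OF div0 L0] flip: y_def L_def)

  \<comment> \<open>First identity: the constant terms -B_2j / (2 (2j)!) supply the coefficients of
    \<open>log_sinc\<close>.\<close>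
  have even_nth: "fps_const ((-1) ^ (j - 1) / of_nat j) * eisenstein (2 * j) =
      fps_const (fps_nth log_sinc (2 * j)) + fps_nth (divisor_log {1..}) (2 * j)" if j: "j \<ge> 1" for j
  proof -
    have "(-1) ^ (j - 1) / of_nat j * (- bernoulli_number (2 * j) / (2 * fact (2 * j))) =
        fps_nth log_sinc (2 * j)"
      using j by (cases j) (simp_all add: log_sinc_def field_simps)
    then have "fps_const (fps_nth log_sinc (2 * j)) = fps_const ((-1) ^ (j - 1) / of_nat j) *
        fps_const (- bernoulli_number (2 * j) / (2 * fact (2 * j)))"
      by (simp only: fps_const_mult)
    then show ?thesis
      using divisor_log_nth[of "{1..}" j] j
      by (simp only: eisenstein_def distrib_left mult.assoc flip: fps_const_mult)
  qed
  have "Abs_fps (\<lambda>k. if even k \<and> k \<ge> 2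
      then fps_const ((-1) ^ (k div 2 - 1) / of_nat (k div 2)) * eisenstein (2 * (k div 2)) else 0)
      = lift_coeffs log_sinc + divisor_log {1..}"
  proof (rule fps_ext)
    show "fps_nth (Abs_fps (\<lambda>k. if even k \<and> k \<ge> 2
        then fps_const ((-1) ^ (k div 2 - 1) / of_nat (k div 2)) * eisenstein (2 * (k div 2)) else 0)) k
        = fps_nth (lift_coeffs log_sinc + divisor_log {1..}) k" for k
      using even_nth[of "k div 2"] by (auto simp: divisor_log_nth_eq_0 log_sinc_def)
  qed
  then have sum_eq: "(\<Sum>\<^sub>\<infinity>j\<in>{1..}. fps_const (fps_const ((-1) ^ (j - 1) / of_nat j) * eisenstein (2 * j)) *
      L ^ (2 * j)) = (lift_coeffs log_sinc + divisor_log {1..}) oo L"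
    by (simp only: infsum_even_powers[OF L0])
  have "macmahon_A r = macmahon_sum {1..} r" for r
    unfolding macmahon_A_def macmahon_sum_def
    by (intro infsum_cong_neutral) (auto simp: decreasing_tuples_def Suc_le_eq)
  then have "1 + (\<Sum>\<^sub>\<infinity>r\<in>{1..}. fps_const (macmahon_A r) * fps_X ^ (2 * r)) = exp_series (divisor_log {1..}) oo L"
    using macmahon_series_eq_exp[of "{1..}"] by (simp add: macmahon_series_def flip: y_def L_def)
  \<comment> \<open>Inserts 1 as Y/X times the exponential of \<open>log_sinc\<close> at Y; this
    exponential then merges with that of \<open>divisor_log\<close>.\<close>
  also have "\<dots> = lift_coeffs (y / fps_X * ((fps_exp 1 oo log_sinc) oo y)) * \<dots>"
    unfolding y_def arcsin_factor_cancels by simp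
  also have "\<dots> = lift_coeffs (y / fps_X) * (exp_series (lift_coeffs log_sinc + divisor_log {1..}) oo L)"
    using exp_series_add[of "lift_coeffs log_sinc" "divisor_log {1..}"]
    by (simp only: lift_coeffs_mult exp_series_lift L_def lift_coeffs_compose[symmetric]
        fps_compose_mult_distrib[OF L0[unfolded L_def]] sinc0 div0 lift_coeffs_nth fps_const_0_eq_0 mult.assoc)
  also have "exp_series (lift_coeffs log_sinc + divisor_log {1..}) oo L =
      exp_series (\<Sum>\<^sub>\<infinity>j\<in>{1..}. fps_const (fps_const ((-1) ^ (j - 1) / of_nat j) * eisenstein (2 * j)) * L ^ (2 * j))"
    unfolding sum_eq by (subst exp_series_compose) (simp_all add: L0 sinc0 div0)
  finally show "1 + (\<Sum>\<^sub>\<infinity>r\<in>{1..}. fps_const (macmahon_A r) * fps_X ^ (2 * r)) =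
      lift_coeffs (2 * arcsin_half / fps_X) *
      exp_series (\<Sum>\<^sub>\<infinity>j\<in>{1..}. fps_const (fps_const ((-1) ^ (j - 1) / of_nat j) * eisenstein (2 * j)) *
        lift_coeffs (2 * arcsin_half) ^ (2 * j))"
    unfolding L_def y_def .
qed

end
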